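(* Let $(Q,I)$ be a quadratic monomial presentation with $Q$ a finite quiver, and let $A=\Bbbk Q/I$. For each circuit $C$ choose a cycle $\bar C\in C$. (i) $\mathrm{HH}_0(A)$ is freely spanned by the homology classes of: the pairs $(e,e)$, one for each vertex $e$ of $Q$; the pairs $(\bar C,s(\bar C))$, one for each cocomplete circuit $C$; and the pairs $(a,s(a))$, one for each loop $a$ in $Q$ such that $a^2\in I$. (ii) $\mathrm{HH}_1(A)$ is freely spanned by the homology classes of: the sums $\llbracket\bar C\rrbracket=\sum_{i=0}^{r-1}\bigl(f'(\mathrm{rot}^i(\bar C)),f(\mathrm{rot}^i(\bar C))\bigr)$, one for each cocomplete circuit $C$, with $r$ the period of $C$; the pairs $\llbracket a\rrbracket=(s(a),a)$ with $a$ a loop such that $a^2\in I$; and the pairs $(\ell(\bar C),\ell'(\bar C))$, one for each complete circuit $C$ of length $2$ whose period $r$ is such that $(-1)^r=1$ in $\Bbbk$. (iii) If $m\ge2$, $\mathrm{HH}_m(A)$ is freely spanned by the homology classes of: the sums $\llbracket\bar C\rrbracket=\sum_{i=0}^{r-1}(-1)^{(m+1)i}\bigl(s(\mathrm{rot}^i(\bar C)),\mathrm{rot}^i(\bar C)\bigr)$, one for each complete circuit $C$ of length $m$ and period $r$ such that $(-1)^{(m+1)r}=1$ in $\Bbbk$; and the pairs $(\ell(\bar C),\ell'(\bar C))$, one for each complete circuit $C$ of length $m+1$ and period $r$ such that $(-1)^{mr}=1$ in $\Bbbk$.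
   Context: $\Bbbk$ is a field. Paths in a quiver are written from right to left ($c_m\cdots c_1$ has first arrow $c_1$ and last arrow $c_m$); vertices are paths of length $0$. A quadratic monomial presentation $(Q,I)$ is a quiver $Q$ with an ideal $I$ of $\Bbbk Q$ generated by a set $R$ of paths of length $2$. $\mathcal B$ is the set of paths with no subpath in $R$ (a basis of $A$), $\Gamma$ the set of paths all of whose subpaths of length $2$ are in $R$, and $\Gamma_m$ its subset of paths of length $m$. For a path $\alpha$ of positive length, $\ell(\alpha)$ is its last arrow, $f(\alpha)$ its first arrow, and $\ell'(\alpha),f'(\alpha)$ are the paths with $\alpha=\ell(\alpha)\ell'(\alpha)=f'(\alpha)f(\alpha)$. $\mathcal B\odot\Gamma_m$ is the set of pairs $(\alpha,\gamma)\in\mathcal B\times\Gamma_m$ with $s(\alpha)=t(\gamma)$ and $t(\alpha)=s(\gamma)$. The spaces $\Bbbk(\mathcal B\odot\Gamma_m)$ with these bases form a chain complex $\Bbbk(\mathcal B\odot\Gamma)$ with $$d_m(\alpha,\gamma)=(\alpha\,\ell(\gamma),\ell'(\gamma))+(-1)^m(f(\gamma)\,\alpha,f'(\gamma)),$$ where a pair whose first component is a path lying in $I$ is interpreted as $0$. This complex is isomorphic to $A\otimes_{A^e}\mathcal R$ with $\mathcal R$ the Bardzell bimodule resolution ($\mathcal R_m=A\otimes_E\Bbbk\Gamma_m\otimes_EA$, $E=\Bbbk Q_0$), and its homology is identified with $\mathrm{HH}_*(A)=\mathrm{Tor}_*^{A^e}(A,A)$. A cycle is a path of positive length with equal source and target;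 $\mathrm{rot}(c_m\cdots c_1)=c_{m-1}\cdots c_1c_m$; a circuit is an equivalence class of cycles under rotation; its period is the least $i\ge1$ with $\mathrm{rot}^i(C)=C$ for any cycle $C$ in it. A cycle $C$ (and its circuit) is complete if $C^2\in\Gamma$, and cocomplete if $C^2\in\mathcal B$. *)

theory Defs
  imports
    "Graph_Theory.Arc_Walk"
    "HOL-Algebra.Ideal"
    "HOL-Library.Poly_Mapping"
begin

section \<open>Paths in a quiver\<close>

text \<open>
  A quiver is a multi-digraph in the sense of \<^verbatim>\<open>Graph_Theory\<close>
  (loops and parallel arrows are allowed). The path written \<open>c\<^sub>m \<cdots> c\<^sub>1\<close>
  (first arrow \<open>c\<^sub>1\<close>, last arrow \<open>c\<^sub>m\<close>) is represented by its source vertex together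
  with its arrows in the order in which they are traversed, that is, by
  \<open>(s c\<^sub>1, [c\<^sub>1, \<dots>, c\<^sub>m])\<close>; the vertex \<open>e\<close>, as a path of length 0, is \<open>(e, [])\<close>.
\<close>

type_synonym ('v, 'a) qpath = "'v \<times> 'a list"

definition vpath :: "'v \<Rightarrow> ('v, 'a) qpath" where
  "vpath e = (e, [])"

definition arrow :: "('v, 'a) pre_digraph \<Rightarrow> 'a \<Rightarrow> ('v, 'a) qpath" where
  "arrow Q a = (tail Q a, [a])"

definition src :: "('v, 'a) qpath \<Rightarrow> 'v" where
  "src p = fst p"

definition tgt :: "('v, 'a) pre_digraph \<Rightarrow> ('v, 'a) qpath \<Rightarrow> 'v" where
  "tgt Q p = last (pre_digraph.awalk_verts Q (fst p) (snd p))"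

definition plength :: "('v, 'a) qpath \<Rightarrow> nat" where
  "plength p = length (snd p)"

definition qpaths :: "('v, 'a) pre_digraph \<Rightarrow> ('v, 'a) qpath set" where
  "qpaths Q = {p. pre_digraph.awalk Q (fst p) (snd p) (tgt Q p)}"

text \<open>
  \<open>p \<cdot> q\<close> is the path \<open>p q\<close> written from right to left: first \<open>q\<close>, then \<open>p\<close>.
  It is meaningful when \<^verbatim>\<open>src p = tgt Q q\<close>.
\<close>

definition pcomp :: "('v, 'a) qpath \<Rightarrow> ('v, 'a) qpath \<Rightarrow> ('v, 'a) qpath" (infixl "\<cdot>" 70) where
  "p \<cdot> q = (fst q, snd q @ snd p)"

text \<open>
  For a path of positive length, \<open>last_arrow\<close>, \<open>but_last\<close>, \<open>first_arrow\<close>, \<open>but_first\<close> are the paths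
  \<open>\<ell>(p)\<close>, \<open>\<ell>'(p)\<close>, \<open>f(p)\<close>, \<open>f'(p)\<close> with \<open>p = \<ell>(p) \<ell>'(p) = f'(p) f(p)\<close>.
\<close>

definition last_arrow :: "('v, 'a) pre_digraph \<Rightarrow> ('v, 'a) qpath \<Rightarrow> ('v, 'a) qpath" where
  "last_arrow Q p = arrow Q (last (snd p))"

definition but_last :: "('v, 'a) qpath \<Rightarrow> ('v, 'a) qpath" where
  "but_last p = (fst p, butlast (snd p))"

definition first_arrow :: "('v, 'a) pre_digraph \<Rightarrow> ('v, 'a) qpath \<Rightarrow> ('v, 'a) qpath" where
  "first_arrow Q p = arrow Q (hd (snd p))"

definition but_first :: "('v, 'a) pre_digraph \<Rightarrow> ('v, 'a) qpath \<Rightarrow> ('v, 'a) qpath" where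
  "but_first Q p = (head Q (hd (snd p)), tl (snd p))"

definition subpath :: "('v, 'a) pre_digraph \<Rightarrow> ('v, 'a) qpath \<Rightarrow> ('v, 'a) qpath \<Rightarrow> bool" where
  "subpath Q q p \<longleftrightarrow>
     (\<exists>u\<in>qpaths Q. \<exists>w\<in>qpaths Q. q \<in> qpaths Q \<and> src u = tgt Q q \<and> src q = tgt Q w \<and> p = u \<cdot> q \<cdot> w)"


section \<open>Quadratic monomial presentations\<close>

text \<open>
  The path algebra \<open>\<k>Q\<close>: finitely supported functions on the set of paths, with the
  bilinear extension of concatenation (products of non-composable paths being 0).
\<close>

definition path_algebra ::
    "('v, 'a) pre_digraph \<Rightarrow> (('v, 'a) qpath \<Rightarrow>\<^sub>0 'k::field) ring" where
  "path_algebra Q =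
     \<lparr> carrier = {x. Poly_Mapping.keys x \<subseteq> qpaths Q},
       mult = (\<lambda>x y. \<Sum>p\<in>Poly_Mapping.keys x. \<Sum>q\<in>Poly_Mapping.keys y.
                 if src p = tgt Q q
                 then Poly_Mapping.single (p \<cdot> q) (Poly_Mapping.lookup x p * Poly_Mapping.lookup y q)
                 else 0),
       one = (\<Sum>e\<in>verts Q. Poly_Mapping.single (vpath e) 1),
       zero = 0,
       add = (+) \<rparr>"

locale quadratic_monomial_presentation = fin_digraph Q
  for Q :: "('v, 'a) pre_digraph" and R :: "('v, 'a) qpath set" +
  assumes relations: "R \<subseteq> {p \<in> qpaths Q. plength p = 2}"

text \<open>The ideal \<open>I\<close> of \<open>\<k>Q\<close> generated by \<open>R\<close>.\<close>

definition pres_ideal ::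
    "('v, 'a) pre_digraph \<Rightarrow> ('v, 'a) qpath set \<Rightarrow> (('v, 'a) qpath \<Rightarrow>\<^sub>0 'k::field) set" where
  "pres_ideal Q R = genideal (path_algebra Q) ((\<lambda>p. Poly_Mapping.single p 1) ` R)"

definition \<B> :: "('v, 'a) pre_digraph \<Rightarrow> ('v, 'a) qpath set \<Rightarrow> ('v, 'a) qpath set" where
  "\<B> Q R = {p \<in> qpaths Q. \<forall>q\<in>R. \<not> subpath Q q p}"

definition \<Gamma> :: "('v, 'a) pre_digraph \<Rightarrow> ('v, 'a) qpath set \<Rightarrow> ('v, 'a) qpath set" where
  "\<Gamma> Q R = {p \<in> qpaths Q. \<forall>q. subpath Q q p \<and> plength q = 2 \<longrightarrow> q \<in> R}"


section \<open>The complex computing Hochschild homology\<close>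

definition BGamma ::
    "('v, 'a) pre_digraph \<Rightarrow> ('v, 'a) qpath set \<Rightarrow> nat \<Rightarrow> (('v, 'a) qpath \<times> ('v, 'a) qpath) set" where
  "BGamma Q R m =
     {(\<alpha>, \<gamma>). \<alpha> \<in> \<B> Q R \<and> \<gamma> \<in> \<Gamma> Q R \<and> plength \<gamma> = m \<and> src \<alpha> = tgt Q \<gamma> \<and> tgt Q \<alpha> = src \<gamma>}"

type_synonym ('v, 'a, 'k) chain = "(('v, 'a) qpath \<times> ('v, 'a) qpath) \<Rightarrow>\<^sub>0 'k"

definition chains ::
    "('v, 'a) pre_digraph \<Rightarrow> ('v, 'a) qpath set \<Rightarrow> nat \<Rightarrow> ('v, 'a, 'k::field) chain set" where
  "chains Q R m = {x. Poly_Mapping.keys x \<subseteq> BGamma Q R m}"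

definition scale :: "'k::field \<Rightarrow> ('b \<Rightarrow>\<^sub>0 'k) \<Rightarrow> ('b \<Rightarrow>\<^sub>0 'k)" where
  "scale c x = Poly_Mapping.map (\<lambda>t. c * t) x"

definition pair :: "('v, 'a) qpath \<Rightarrow> ('v, 'a) qpath \<Rightarrow> ('v, 'a, 'k::field) chain" where
  "pair \<alpha> \<gamma> = Poly_Mapping.single (\<alpha>, \<gamma>) 1"

text \<open>The pair \<open>(\<alpha>, \<gamma>)\<close>, interpreted as 0 when the path \<open>\<alpha>\<close> lies in \<open>I\<close>.\<close>

definition pair_mod ::
    "('v, 'a) pre_digraph \<Rightarrow> ('v, 'a) qpath set \<Rightarrow> ('v, 'a) qpath \<Rightarrow> ('v, 'a) qpath
      \<Rightarrow> ('v, 'a, 'k::field) chain" where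
  "pair_mod Q R \<alpha> \<gamma> = (if Poly_Mapping.single \<alpha> (1::'k) \<in> pres_ideal Q R then 0 else pair \<alpha> \<gamma>)"

definition bdry_pair ::
    "('v, 'a) pre_digraph \<Rightarrow> ('v, 'a) qpath set \<Rightarrow> nat \<Rightarrow> ('v, 'a) qpath \<Rightarrow> ('v, 'a) qpath
      \<Rightarrow> ('v, 'a, 'k::field) chain" where
  "bdry_pair Q R m \<alpha> \<gamma> =
     pair_mod Q R (\<alpha> \<cdot> last_arrow Q \<gamma>) (but_last \<gamma>)
     + scale ((-1) ^ m) (pair_mod Q R (first_arrow Q \<gamma> \<cdot> \<alpha>) (but_first Q \<gamma>))"

definition bdry ::
    "('v, 'a) pre_digraph \<Rightarrow> ('v, 'a) qpath set \<Rightarrow> nat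
      \<Rightarrow> ('v, 'a, 'k::field) chain \<Rightarrow> ('v, 'a, 'k) chain" where
  "bdry Q R m x =
     (if m = 0 then 0
      else \<Sum>(\<alpha>, \<gamma>)\<in>Poly_Mapping.keys x.
        scale (Poly_Mapping.lookup x (\<alpha>, \<gamma>)) (bdry_pair Q R m \<alpha> \<gamma>))"

definition hcycles ::
    "('v, 'a) pre_digraph \<Rightarrow> ('v, 'a) qpath set \<Rightarrow> nat \<Rightarrow> ('v, 'a, 'k::field) chain set" where
  "hcycles Q R m = {x \<in> chains Q R m. bdry Q R m x = 0}"

definition hboundaries ::
    "('v, 'a) pre_digraph \<Rightarrow> ('v, 'a) qpath set \<Rightarrow> nat \<Rightarrow> ('v, 'a, 'k::field) chain set" where
  "hboundaries Q R m = bdry Q R (Suc m) ` chains Q R (Suc m)"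

definition hclass ::
    "('v, 'a) pre_digraph \<Rightarrow> ('v, 'a) qpath set \<Rightarrow> nat
      \<Rightarrow> ('v, 'a, 'k::field) chain \<Rightarrow> ('v, 'a, 'k) chain set" where
  "hclass Q R m z = (\<lambda>b. z + b) ` hboundaries Q R m"

text \<open>
  \<open>HH\<^sub>m(A)\<close> for \<open>A = \<k>Q/I\<close>, computed by the complex \<open>A \<otimes>\<^bsub>A\<^sup>e\<^esub> \<R>\<close> of the Bardzell bimodule
  resolution \<open>\<R>\<close> of \<open>A\<close>, written in its basis \<open>\<B> \<odot> \<Gamma>\<close>; its elements are the cosets of the
  boundaries in the cycles.
\<close>

definition HH ::
    "('v, 'a) pre_digraph \<Rightarrow> ('v, 'a) qpath set \<Rightarrow> nat \<Rightarrow> ('v, 'a, 'k::field) chain set set" where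
  "HH Q R m = hclass Q R m ` hcycles Q R m"

text \<open>
  The family of the homology classes of the \<open>z j\<close>, \<open>j \<in> J\<close>, is a basis of \<open>HH\<^sub>m(A)\<close>. As it is
  indexed by \<open>J\<close>, different indices give different classes. A linear combination
  of classes in the quotient space is the class of the linear combination of representatives.
\<close>

definition freely_spanned_by_classes ::
    "('v, 'a) pre_digraph \<Rightarrow> ('v, 'a) qpath set \<Rightarrow> nat
      \<Rightarrow> 'j set \<Rightarrow> ('j \<Rightarrow> ('v, 'a, 'k::field) chain) \<Rightarrow> bool" where
  "freely_spanned_by_classes Q R m J z \<longleftrightarrow>
     (\<forall>j\<in>J. z j \<in> hcycles Q R m) \<and>
     (\<forall>h\<in>HH Q R m. \<exists>!c :: 'j \<Rightarrow>\<^sub>0 'k.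
        Poly_Mapping.keys c \<subseteq> J \<and>
        h = hclass Q R m (\<Sum>j\<in>Poly_Mapping.keys c. scale (Poly_Mapping.lookup c j) (z j)))"


section \<open>Cycles and circuits\<close>

definition qcycles :: "('v, 'a) pre_digraph \<Rightarrow> ('v, 'a) qpath set" where
  "qcycles Q = {p \<in> qpaths Q. plength p > 0 \<and> src p = tgt Q p}"

text \<open>\<open>rot (c\<^sub>m c\<^bsub>m-1\<^esub> \<cdots> c\<^sub>1) = c\<^bsub>m-1\<^esub> \<cdots> c\<^sub>1 c\<^sub>m\<close>\<close>

definition rot :: "('v, 'a) pre_digraph \<Rightarrow> ('v, 'a) qpath \<Rightarrow> ('v, 'a) qpath" where
  "rot Q p = but_last p \<cdot> last_arrow Q p"

definition circuits :: "('v, 'a) pre_digraph \<Rightarrow> ('v, 'a) qpath set set" where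
  "circuits Q = qcycles Q // {(c, c'). c \<in> qcycles Q \<and> (\<exists>i. c' = (rot Q ^^ i) c)}"

definition circuits_of_length :: "('v, 'a) pre_digraph \<Rightarrow> nat \<Rightarrow> ('v, 'a) qpath set set" where
  "circuits_of_length Q m = {C \<in> circuits Q. \<forall>c\<in>C. plength c = m}"

definition period :: "('v, 'a) pre_digraph \<Rightarrow> ('v, 'a) qpath set \<Rightarrow> nat" where
  "period Q C = (LEAST i. i \<ge> 1 \<and> (\<forall>c\<in>C. (rot Q ^^ i) c = c))"

definition complete_circuit ::
    "('v, 'a) pre_digraph \<Rightarrow> ('v, 'a) qpath set \<Rightarrow> ('v, 'a) qpath set \<Rightarrow> bool" where
  "complete_circuit Q R C \<longleftrightarrow> C \<in> circuits Q \<and> (\<exists>c\<in>C. c \<cdot> c \<in> \<Gamma> Q R)"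

definition cocomplete_circuit ::
    "('v, 'a) pre_digraph \<Rightarrow> ('v, 'a) qpath set \<Rightarrow> ('v, 'a) qpath set \<Rightarrow> bool" where
  "cocomplete_circuit Q R C \<longleftrightarrow> C \<in> circuits Q \<and> (\<exists>c\<in>C. c \<cdot> c \<in> \<B> Q R)"

end

(*
  Writing a basis pair (alpha, gamma) as the closed path c = alpha gamma, the differential is
  d_m c = [c] + (-1)^m [tau c], where tau moves the first arrow of c to its end and [c] is the basis
  element of degree m - 1 given by c, or 0 if c does not split into a path in B and a path of length
  m - 1 in Gamma. A closed path of positive length that gives a basis element of degree m gives one
  in exactly one of the degrees m - 1 and m + 1. Hence, for the map s sending c in degree m to [c]
  in degree m + 1, the map 1 - ds - sd is plus or minus tau on the closed paths c for which c and
  tau c both give basis elements of the same two consecutive degrees, fixes the vertices, and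
  vanishes elsewhere. So homology is carried by these closed paths, which are the complete and the
  cocomplete cycles; on the circuit of such a cycle the complex is the two-term complex
  1 - (-1)^(m+1) tau, whose kernel and cokernel are read off from the period.
*)

theory Submission
  imports Defs
begin


section \<open>Linear extension\<close>

text \<open>The homotopy yields spanning only. Independence comes from functionals that vanish on
  boundaries: a single coefficient for the upper term of a two-term complex, a signed sum over one
  period for the lower term. So the decomposition into circuits never has to be stated as a direct
  sum. The conditions on the period come from going once round a circuit: r rotations compose to the
  identity but multiply a coefficient by a sign. If that sign is not 1 in the field, the upper term
  contains no nonzero cycle and the lower term consists of boundaries. The period counts here and
  not the length, since a cycle may be a proper power. Loops with square in I are complete circuits
  of length 1, so they occupy degrees 0 and 1, as do cocomplete cycles of every length. The relevant
  signs there are \<open>(-1)^0\<close> and \<open>(-1)^(2*r)\<close>, which is why these families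
  carry no condition.\<close>

lemma lookup_scale [simp]: "Poly_Mapping.lookup (scale c x) k = c * Poly_Mapping.lookup x k"
  by (simp add: scale_def Poly_Mapping.map.rep_eq when_def)

lemma scale_zero [simp]: "scale c 0 = 0"
  and scale_zero_left [simp]: "scale 0 x = 0"
  and scale_one [simp]: "scale 1 x = x"
  and scale_scale [simp]: "scale a (scale b x) = scale (a * b) x"
  and scale_add: "scale c (x + y) = scale c x + scale c y"
  and scale_add_left: "scale (a + b) x = scale a x + scale b x"
  and scale_minus: "scale c (x - y) = scale c x - scale c y"
  and scale_minus_left: "scale (- c) x = - scale c x"
  and scale_single: "scale c (Poly_Mapping.single k a) = Poly_Mapping.single k (c * a)"
  by (auto intro!: poly_mapping_eqI
      simp: lookup_add lookup_minus lookup_single when_def algebra_simps)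

lemma scale_sum: "scale c (sum f S) = (\<Sum>i\<in>S. scale c (f i))"
  by (induction S rule: infinite_finite_induct) (auto simp: scale_add)

lemma keys_sum_subset: "Poly_Mapping.keys (sum f S) \<subseteq> (\<Union>i\<in>S. Poly_Mapping.keys (f i))"
proof (induction S rule: infinite_finite_induct)
  case (insert i S)
  then show ?case
    using keys_add[of "f i" "sum f S"] by auto
qed auto

lemma keys_scale_subset: "Poly_Mapping.keys (scale c x) \<subseteq> Poly_Mapping.keys x"
  by (auto simp: in_keys_iff)

definition lin_ext ::
    "('b \<Rightarrow> ('c \<Rightarrow>\<^sub>0 'k::field)) \<Rightarrow> ('b \<Rightarrow>\<^sub>0 'k) \<Rightarrow> ('c \<Rightarrow>\<^sub>0 'k)" where
  "lin_ext f x = (\<Sum>b\<in>Poly_Mapping.keys x. scale (Poly_Mapping.lookup x b) (f b))"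

text \<open>Summing over a common finite set is what makes additivity provable, as cancellation can
  make the support of a sum smaller than the union of the supports.\<close>

lemma lin_ext_superset:
  assumes "finite S" "Poly_Mapping.keys x \<subseteq> S"
  shows "lin_ext f x = (\<Sum>b\<in>S. scale (Poly_Mapping.lookup x b) (f b))"
  unfolding lin_ext_def using assms
  by (intro sum.mono_neutral_left) (auto simp: in_keys_iff)

lemma lin_ext_zero [simp]: "lin_ext f 0 = 0"
  by (simp add: lin_ext_def)

lemma lin_ext_add: "lin_ext f (x + y) = lin_ext f x + lin_ext f y"
proof -
  let ?S = "Poly_Mapping.keys x \<union> Poly_Mapping.keys y"
  have "Poly_Mapping.keys (x + y) \<subseteq> ?S"
    by (rule keys_add)
  then show ?thesis
    by (simp add: lin_ext_superset[of ?S] lookup_add scale_add_left sum.distrib)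
qed

lemma lin_ext_scale: "lin_ext f (scale c x) = scale c (lin_ext f x)"
  using keys_scale_subset[of c x]
  by (simp add: lin_ext_superset[of "Poly_Mapping.keys x"] scale_sum)

lemma lin_ext_minus: "lin_ext f (x - y) = lin_ext f x - lin_ext f y"
  using lin_ext_add[of f "x - y" y] by (simp add: algebra_simps)

lemma lin_ext_sum: "lin_ext f (sum g S) = (\<Sum>i\<in>S. lin_ext f (g i))"
  by (induction S rule: infinite_finite_induct) (auto simp: lin_ext_add)

lemma lin_ext_single [simp]: "lin_ext f (Poly_Mapping.single b a) = scale a (f b)"
  by (simp add: lin_ext_def)

lemma lin_ext_cong:
  assumes "\<And>b. b \<in> Poly_Mapping.keys x \<Longrightarrow> f b = g b"
  shows "lin_ext f x = lin_ext g x"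
  using assms by (simp add: lin_ext_def)

lemma lin_ext_ident [simp]: "lin_ext (\<lambda>b. Poly_Mapping.single b 1) x = x"
proof (rule poly_mapping_eqI)
  fix k
  show "Poly_Mapping.lookup (lin_ext (\<lambda>b. Poly_Mapping.single b 1) x) k = Poly_Mapping.lookup x k"
    by (cases "k \<in> Poly_Mapping.keys x")
      (auto simp: lin_ext_def lookup_sum lookup_single when_def in_keys_iff if_distrib
        sum.delta' cong: if_cong)
qed

lemma lin_ext_add_fun: "lin_ext (\<lambda>b. f b + g b) x = lin_ext f x + lin_ext g x"
  by (simp add: lin_ext_def scale_add sum.distrib)

lemma lin_ext_minus_fun: "lin_ext (\<lambda>b. f b - g b) x = lin_ext f x - lin_ext g x"
  by (simp add: lin_ext_def scale_minus sum_subtractf)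

lemma lin_ext_zero_fun [simp]: "lin_ext (\<lambda>b. 0) x = 0"
  by (simp add: lin_ext_def)

lemma lin_ext_comp: "lin_ext g (lin_ext f x) = lin_ext (\<lambda>b. lin_ext g (f b)) x"
proof -
  have "lin_ext g (lin_ext f x) =
      lin_ext g (\<Sum>b\<in>Poly_Mapping.keys x. scale (Poly_Mapping.lookup x b) (f b))"
    by (simp only: lin_ext_def[of f])
  also have "\<dots> = (\<Sum>b\<in>Poly_Mapping.keys x. scale (Poly_Mapping.lookup x b) (lin_ext g (f b)))"
    by (simp only: lin_ext_sum lin_ext_scale)
  finally show ?thesis
    by (simp only: lin_ext_def[of "\<lambda>b. lin_ext g (f b)"])
qed

lemma lookup_lin_ext:
  "Poly_Mapping.lookup (lin_ext f x) k =
     (\<Sum>b\<in>Poly_Mapping.keys x. Poly_Mapping.lookup x b * Poly_Mapping.lookup (f b) k)"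
  by (simp add: lin_ext_def lookup_sum)

lemma keys_lin_ext_subset:
  "Poly_Mapping.keys (lin_ext f x) \<subseteq> (\<Union>b\<in>Poly_Mapping.keys x. Poly_Mapping.keys (f b))"
  unfolding lin_ext_def using keys_scale_subset by (intro order.trans[OF keys_sum_subset]) fast


section \<open>The path algebra and the monomial ideal\<close>

definition pprod :: "('v, 'a) pre_digraph \<Rightarrow> ('v, 'a) qpath \<Rightarrow> ('v, 'a) qpath
    \<Rightarrow> (('v, 'a) qpath \<Rightarrow>\<^sub>0 'k::field)" where
  "pprod Q p q = (if src p = tgt Q q then Poly_Mapping.single (p \<cdot> q) 1 else 0)"

text \<open>In this form the product is a bilinear extension, so the ring laws reduce to identities
  between single paths.\<close>

lemma path_algebra_mult:
  "mult (path_algebra Q) x y = lin_ext (\<lambda>p. lin_ext (pprod Q p) y) x"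
  by (simp add: path_algebra_def lin_ext_def scale_sum pprod_def if_distrib[of "scale _"]
      scale_single cong: if_cong)

lemma src_pcomp [simp]: "src (p \<cdot> q) = src q"
  by (simp add: src_def pcomp_def)

lemma tgt_eq: "tgt Q p = (if snd p = [] then fst p else head Q (last (snd p)))"
  by (simp add: tgt_def pre_digraph.awalk_verts_conv)

lemma tgt_pcomp: "src p = tgt Q q \<Longrightarrow> tgt Q (p \<cdot> q) = tgt Q p"
  by (auto simp: tgt_eq pcomp_def src_def)

lemma pcomp_assoc: "p \<cdot> q \<cdot> r = p \<cdot> (q \<cdot> r)"
  by (simp add: pcomp_def)

lemma pcomp_vpath_left: "vpath (tgt Q q) \<cdot> q = q"
  and pcomp_vpath_right: "p \<cdot> vpath (src p) = p"
  by (simp_all add: pcomp_def vpath_def src_def)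

lemma pprod_assoc:
  "lin_ext (\<lambda>s. pprod Q s r) (pprod Q p q) = lin_ext (pprod Q p) (pprod Q q r)"
  by (auto simp: pprod_def tgt_pcomp pcomp_assoc)

context quadratic_monomial_presentation
begin

lemma in_qpaths_iff:
  "p \<in> qpaths Q \<longleftrightarrow> fst p \<in> verts Q \<and> set (snd p) \<subseteq> arcs Q \<and>
     successively (\<lambda>a b. head Q a = tail Q b) (snd p) \<and>
     (snd p = [] \<or> tail Q (hd (snd p)) = fst p)"
proof -
  have "cas v cs (tgt Q (v, cs)) \<longleftrightarrow>
      successively (\<lambda>a b. head Q a = tail Q b) cs \<and> (cs = [] \<or> tail Q (hd cs) = v)" for v cs
    by (induction cs arbitrary: v) (auto simp: tgt_eq successively_Cons)
  then show ?thesis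
    by (cases p) (auto simp: qpaths_def awalk_def)
qed

lemma src_in_verts: "p \<in> qpaths Q \<Longrightarrow> src p \<in> verts Q"
  by (simp add: in_qpaths_iff src_def)

lemma tgt_in_verts: "p \<in> qpaths Q \<Longrightarrow> tgt Q p \<in> verts Q"
  using last_in_set by (fastforce simp: in_qpaths_iff tgt_eq)

lemma vpath_in_qpaths: "e \<in> verts Q \<Longrightarrow> vpath e \<in> qpaths Q"
  by (simp add: in_qpaths_iff vpath_def)

lemma pcomp_in_qpaths_iff:
  assumes "src p = tgt Q q"
  shows "p \<cdot> q \<in> qpaths Q \<longleftrightarrow> p \<in> qpaths Q \<and> q \<in> qpaths Q"
proof -
  have "head Q (last (snd q)) \<in> verts Q" if "snd q \<noteq> []" "set (snd q) \<subseteq> arcs Q"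
    using that by (meson head_in_verts last_in_set subsetD)
  then show ?thesis
    using assms by (auto simp: in_qpaths_iff pcomp_def src_def tgt_eq successively_append_iff split: if_splits)
qed

lemma keys_pprod: "\<lbrakk>p \<in> qpaths Q; q \<in> qpaths Q\<rbrakk> \<Longrightarrow> Poly_Mapping.keys (pprod Q p q) \<subseteq> qpaths Q"
  by (auto simp: pprod_def pcomp_in_qpaths_iff)

text \<open>Needed for \<open>pres_ideal\<close> to have its intended meaning:
  \<open>genideal\<close> intersects all sets satisfying \<open>ideal\<close>, a predicate that
  includes the ring laws, so without them the intersection would be over an empty family.\<close>

lemma ring_path_algebra: "ring (path_algebra Q :: (('v, 'a) qpath \<Rightarrow>\<^sub>0 'k::field) ring)"
proof (rule ringI)
  let ?A = "path_algebra Q :: (('v, 'a) qpath \<Rightarrow>\<^sub>0 'k) ring"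
  have carrier: "x \<in> carrier ?A \<longleftrightarrow> Poly_Mapping.keys x \<subseteq> qpaths Q" for x
    by (simp add: path_algebra_def)
  have add: "x \<oplus>\<^bsub>?A\<^esub> y = x + y" for x y
    by (simp add: path_algebra_def)
  show "abelian_group ?A"
  proof (rule abelian_groupI)
    fix x y assume "x \<in> carrier ?A" "y \<in> carrier ?A"
    then show "x \<oplus>\<^bsub>?A\<^esub> y \<in> carrier ?A"
      using keys_add[of x y] by (auto simp: carrier add)
  next
    fix x assume "x \<in> carrier ?A"
    then show "\<exists>y\<in>carrier ?A. y \<oplus>\<^bsub>?A\<^esub> x = \<zero>\<^bsub>?A\<^esub>"
      by (intro bexI[of _ "- x"]) (auto simp: path_algebra_def)
  qed (auto simp: path_algebra_def algebra_simps)
  have one: "\<one>\<^bsub>?A\<^esub> = (\<Sum>e\<in>verts Q. Poly_Mapping.single (vpath e) 1)"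
    by (simp add: path_algebra_def)
  show "monoid ?A"
  proof (rule monoidI)
    fix x y assume xy: "x \<in> carrier ?A" "y \<in> carrier ?A"
    have "Poly_Mapping.keys (lin_ext (pprod Q p) y) \<subseteq> qpaths Q" if "p \<in> Poly_Mapping.keys x" for p
      using keys_lin_ext_subset[of "pprod Q p" y] keys_pprod[of p] that xy
      by (fastforce simp: carrier)
    then show "x \<otimes>\<^bsub>?A\<^esub> y \<in> carrier ?A"
      using keys_lin_ext_subset[of "\<lambda>p. lin_ext (pprod Q p) y" x]
      by (fastforce simp: carrier path_algebra_mult)
  next
    show "\<one>\<^bsub>?A\<^esub> \<in> carrier ?A"
    proof -
      have "Poly_Mapping.keys (\<Sum>e\<in>verts Q. Poly_Mapping.single (vpath e) (1::'k)) \<subseteq> vpath ` verts Q"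
        by (rule order.trans[OF keys_sum_subset]) auto
      then show ?thesis
        using vpath_in_qpaths by (fastforce simp: carrier one)
    qed
  next
    fix x y z assume "x \<in> carrier ?A" "y \<in> carrier ?A" "z \<in> carrier ?A"
    have "lin_ext (\<lambda>s. lin_ext (pprod Q s) z) (pprod Q p q) = lin_ext (pprod Q p) (lin_ext (pprod Q q) z)"
      for p q
    proof -
      \<comment> \<open>The two extensions can be interchanged because \<open>pprod Q p q\<close> is
        a single path or 0.\<close>
      have "lin_ext (\<lambda>s. lin_ext (pprod Q s) z) (pprod Q p q) =
          lin_ext (\<lambda>r. lin_ext (\<lambda>s. pprod Q s r) (pprod Q p q)) z"
        by (cases "src p = tgt Q q") (simp_all add: pprod_def[of Q p q])
      then show ?thesis
        by (simp add: pprod_assoc lin_ext_comp)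
    qed
    then show "x \<otimes>\<^bsub>?A\<^esub> y \<otimes>\<^bsub>?A\<^esub> z = x \<otimes>\<^bsub>?A\<^esub> (y \<otimes>\<^bsub>?A\<^esub> z)"
      by (simp add: path_algebra_mult lin_ext_comp)
  next
    fix x assume x: "x \<in> carrier ?A"
    have "\<one>\<^bsub>?A\<^esub> \<otimes>\<^bsub>?A\<^esub> x = lin_ext (\<lambda>q. \<Sum>e\<in>verts Q. pprod Q (vpath e) q) x"
      by (simp add: one path_algebra_mult lin_ext_sum) (simp add: lin_ext_def scale_sum sum.swap[of _ "verts Q"])
    also have "\<dots> = lin_ext (\<lambda>q. Poly_Mapping.single q 1) x"
    proof (rule lin_ext_cong)
      fix q assume "q \<in> Poly_Mapping.keys x"
      then have "tgt Q q \<in> verts Q"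
        using x by (auto simp: carrier intro!: tgt_in_verts)
      moreover have "pprod Q (vpath e) q = (if e = tgt Q q then Poly_Mapping.single q (1::'k) else 0)" for e
        using pcomp_vpath_left[of Q q] by (auto simp: pprod_def src_def vpath_def)
      ultimately show "(\<Sum>e\<in>verts Q. pprod Q (vpath e) q) = Poly_Mapping.single q (1::'k)"
        by simp
    qed
    finally show "\<one>\<^bsub>?A\<^esub> \<otimes>\<^bsub>?A\<^esub> x = x"
      by simp
    have "x \<otimes>\<^bsub>?A\<^esub> \<one>\<^bsub>?A\<^esub> = lin_ext (\<lambda>p. \<Sum>e\<in>verts Q. pprod Q p (vpath e)) x"
      by (simp add: one path_algebra_mult lin_ext_sum)
    also have "\<dots> = lin_ext (\<lambda>q. Poly_Mapping.single q 1) x"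
    proof (rule lin_ext_cong)
      fix q assume "q \<in> Poly_Mapping.keys x"
      then have "src q \<in> verts Q"
        using x by (auto simp: carrier intro!: src_in_verts)
      moreover have "pprod Q q (vpath e) = (if e = src q then Poly_Mapping.single q (1::'k) else 0)" for e
        using pcomp_vpath_right[of q] by (auto simp: pprod_def tgt_eq vpath_def)
      ultimately show "(\<Sum>e\<in>verts Q. pprod Q q (vpath e)) = Poly_Mapping.single q (1::'k)"
        by simp
    qed
    finally show "x \<otimes>\<^bsub>?A\<^esub> \<one>\<^bsub>?A\<^esub> = x"
      by simp
  qed
qed (simp_all add: path_algebra_mult lin_ext_add lin_ext_add_fun,
    simp_all add: path_algebra_def lin_ext_add lin_ext_add_fun)

end


section \<open>Relations as a condition on adjacent arrows\<close>

lemma successively_iff_factors: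
  "successively P xs \<longleftrightarrow> (\<forall>us a b ws. xs = us @ [a, b] @ ws \<longrightarrow> P a b)"
proof
  assume "\<forall>us a b ws. xs = us @ [a, b] @ ws \<longrightarrow> P a b"
  then show "successively P xs"
  proof (induction P xs rule: successively.induct)
    case (3 P x y xs)
    have "P x y"
      using 3(2)[rule_format, of "[]" x y xs] by simp
    moreover have "successively P (y # xs)"
      by (rule 3(1)) (metis 3(2) append_Cons)
    ultimately show ?case
      by simp
  qed auto
qed (auto simp: successively_append_iff)

context quadratic_monomial_presentation
begin

text \<open>A path of positive length starts at the tail of its first arrow, so this relation on
  arrows carries the same information as \<open>R\<close>.\<close>

definition rel :: "'a \<Rightarrow> 'a \<Rightarrow> bool" where
  "rel a b \<longleftrightarrow> (tail Q a, [a, b]) \<in> R"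

lemma subpath_length_2_iff:
  assumes "p \<in> qpaths Q"
  shows "subpath Q q p \<and> plength q = 2 \<longleftrightarrow>
    (\<exists>us a b ws. snd p = us @ [a, b] @ ws \<and> q = (tail Q a, [a, b]))"
proof
  assume "subpath Q q p \<and> plength q = 2"
  then obtain u w where q: "q \<in> qpaths Q" "plength q = 2" "p = u \<cdot> q \<cdot> w"
    by (auto simp: subpath_def)
  then obtain a b where "snd q = [a, b]"
    by (auto simp: plength_def length_Suc_conv numeral_2_eq_2)
  moreover from this q have "fst q = tail Q a"
    by (simp add: in_qpaths_iff)
  ultimately show "\<exists>us a b ws. snd p = us @ [a, b] @ ws \<and> q = (tail Q a, [a, b])"
    using q(3) by (intro exI[of _ "snd w"] exI[of _ a] exI[of _ b] exI[of _ "snd u"])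
      (auto simp: pcomp_def prod_eq_iff)
next
  assume "\<exists>us a b ws. snd p = us @ [a, b] @ ws \<and> q = (tail Q a, [a, b])"
  then obtain us a b ws where p: "snd p = us @ [a, b] @ ws" and q: "q = (tail Q a, [a, b])"
    by blast
  let ?u = "(head Q b, ws)" and ?w = "(fst p, us)"
  have "?u \<in> qpaths Q" "?w \<in> qpaths Q" "q \<in> qpaths Q" "src ?u = tgt Q q" "src q = tgt Q ?w" "p = ?u \<cdot> q \<cdot> ?w"
    using assms p q
    by (auto simp: in_qpaths_iff successively_append_iff successively_Cons src_def tgt_eq pcomp_def
        prod_eq_iff hd_append split: if_splits)
  then show "subpath Q q p \<and> plength q = 2"
    by (auto simp: subpath_def plength_def q)
qed

text \<open>As all elements of \<open>R\<close> have length 2, membership is a condition on adjacent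
  arrows. It is exactly opposite to the one for \<Gamma>, and this opposition drives the whole
  computation.\<close>

lemma in_B_iff:
  "p \<in> \<B> Q R \<longleftrightarrow> p \<in> qpaths Q \<and> successively (\<lambda>a b. \<not> rel a b) (snd p)"
proof -
  have "(\<forall>q\<in>R. \<not> subpath Q q p) \<longleftrightarrow> (\<forall>q\<in>R. \<not> (subpath Q q p \<and> plength q = 2))"
    using relations by blast
  also have "\<dots> \<longleftrightarrow> successively (\<lambda>a b. \<not> rel a b) (snd p)" if "p \<in> qpaths Q"
    unfolding subpath_length_2_iff[OF that] successively_iff_factors rel_def by blast
  finally show ?thesis
    by (auto simp: \<B>_def)
qed

lemma in_Gamma_iff:
  "p \<in> \<Gamma> Q R \<longleftrightarrow> p \<in> qpaths Q \<and> successively rel (snd p)"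
proof -
  have "(\<forall>q. subpath Q q p \<and> plength q = 2 \<longrightarrow> q \<in> R) \<longleftrightarrow> successively rel (snd p)"
    if "p \<in> qpaths Q"
    unfolding subpath_length_2_iff[OF that] successively_iff_factors rel_def by blast
  then show ?thesis
    by (auto simp: \<Gamma>_def)
qed

text \<open>Concatenation cannot destroy a subpath, so the paths outside \<B> span an ideal; it
  contains \<open>R\<close>, hence I. Conversely a path outside \<B> has the form u q w with q in
  \<open>R\<close>, and every ideal containing q contains it.\<close>

lemma single_in_pres_ideal_iff:
  assumes "p \<in> qpaths Q"
  shows "Poly_Mapping.single p (1::'k::field) \<in> pres_ideal Q R \<longleftrightarrow> p \<notin> \<B> Q R"
proof
  let ?A = "path_algebra Q :: (('v, 'a) qpath \<Rightarrow>\<^sub>0 'k) ring"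
  let ?M = "{x. Poly_Mapping.keys x \<subseteq> qpaths Q - \<B> Q R} :: (('v, 'a) qpath \<Rightarrow>\<^sub>0 'k) set"
  interpret A: ring ?A
    by (rule ring_path_algebra)
  have carrier: "x \<in> carrier ?A \<longleftrightarrow> Poly_Mapping.keys x \<subseteq> qpaths Q" for x
    by (simp add: path_algebra_def)
  have R: "q \<in> qpaths Q - \<B> Q R" if "q \<in> R" for q
  proof -
    obtain a b where "snd q = [a, b]"
      using subsetD[OF relations \<open>q \<in> R\<close>] by (auto simp: plength_def numeral_2_eq_2 length_Suc_conv)
    moreover from this have "fst q = tail Q a"
      using that relations by (auto simp: in_qpaths_iff)
    ultimately show ?thesis
      using that relations by (cases q) (auto simp: in_B_iff rel_def)
  qed
  have "ideal ?M ?A"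
  proof (rule idealI)
    show "subgroup ?M (add_monoid ?A)"
    proof (rule A.add.subgroupI)
      fix x assume x: "x \<in> ?M"
      then have "- x \<in> carrier ?A"
        by (auto simp: carrier)
      moreover have "\<ominus>\<^bsub>?A\<^esub> x = - x"
        using x by (intro A.minus_equality) (auto simp: carrier, auto simp: path_algebra_def)
      ultimately show "\<ominus>\<^bsub>?A\<^esub> x \<in> ?M"
        using x by simp
    next
      fix x y assume "x \<in> ?M" "y \<in> ?M"
      then show "x \<oplus>\<^bsub>?A\<^esub> y \<in> ?M"
        using keys_add[of x y] by (fastforce simp: path_algebra_def)
    qed (auto simp: carrier intro: exI[of _ 0])
  next
    fix a x assume a: "a \<in> ?M" and x: "x \<in> carrier ?A"
    have "p \<cdot> q \<in> qpaths Q - \<B> Q R"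
      if "p \<in> qpaths Q" "q \<in> qpaths Q" "src p = tgt Q q" "p \<notin> \<B> Q R \<or> q \<notin> \<B> Q R" for p q
      using that by (auto simp: in_B_iff pcomp_in_qpaths_iff) (auto simp: pcomp_def successively_append_iff)
    then have "Poly_Mapping.keys (pprod Q p q :: _ \<Rightarrow>\<^sub>0 'k) \<subseteq> qpaths Q - \<B> Q R"
      if "p \<in> qpaths Q" "q \<in> qpaths Q" "p \<notin> \<B> Q R \<or> q \<notin> \<B> Q R" for p q
      using that by (simp add: pprod_def)
    note * = this
    show "x \<otimes>\<^bsub>?A\<^esub> a \<in> ?M"
      unfolding path_algebra_mult using a x
      by (auto simp: carrier dest!: subsetD[OF keys_lin_ext_subset] subsetD[OF *, rotated 3])
    show "a \<otimes>\<^bsub>?A\<^esub> x \<in> ?M"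
      unfolding path_algebra_mult using a x
      by (auto simp: carrier dest!: subsetD[OF keys_lin_ext_subset] subsetD[OF *, rotated 3])
  qed (rule ring_path_algebra)
  moreover have "(\<lambda>p. Poly_Mapping.single p 1) ` R \<subseteq> ?M"
    using R by auto
  ultimately have "pres_ideal Q R \<subseteq> ?M"
    by (auto simp: pres_ideal_def genideal_def)
  then show "p \<notin> \<B> Q R" if "Poly_Mapping.single p (1::'k) \<in> pres_ideal Q R"
    using that by auto
  show "Poly_Mapping.single p (1::'k) \<in> pres_ideal Q R" if "p \<notin> \<B> Q R"
  proof -
    obtain q where q: "q \<in> R" "subpath Q q p"
      using \<open>p \<notin> \<B> Q R\<close> assms by (auto simp: \<B>_def)
    then obtain u w where uw: "u \<in> qpaths Q" "w \<in> qpaths Q" "src u = tgt Q q" "src q = tgt Q w"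
      "p = u \<cdot> q \<cdot> w"
      by (auto simp: subpath_def)
    have mult: "Poly_Mapping.single p 1 =
        (Poly_Mapping.single u 1 \<otimes>\<^bsub>?A\<^esub> Poly_Mapping.single q 1) \<otimes>\<^bsub>?A\<^esub> Poly_Mapping.single w 1"
      using uw by (simp add: path_algebra_mult pprod_def)
    have "Poly_Mapping.single p 1 \<in> I" if "ideal I ?A" "(\<lambda>p. Poly_Mapping.single p 1) ` R \<subseteq> I" for I
    proof -
      interpret ideal I ?A by fact
      show ?thesis
        unfolding mult using that q(1) uw
        by (intro I_r_closed I_l_closed) (auto simp: carrier)
    qed
    then show ?thesis
      by (auto simp: pres_ideal_def genideal_def)
  qed
qed

end


section \<open>Closed paths\<close>

definition closed_paths :: "('v, 'a) pre_digraph \<Rightarrow> ('v, 'a) qpath set" where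
  "closed_paths Q = {c \<in> qpaths Q. src c = tgt Q c}"

text \<open>On a path of length 0, \<^const>\<open>rot\<close> depends on the junk value of \<^term>\<open>last []\<close>; the rotations
  below fix such a path.\<close>

definition rot_right :: "('v, 'a) pre_digraph \<Rightarrow> ('v, 'a) qpath \<Rightarrow> ('v, 'a) qpath" where
  "rot_right Q c = (if snd c = [] then c else rot Q c)"

definition rot_left :: "('v, 'a) pre_digraph \<Rightarrow> ('v, 'a) qpath \<Rightarrow> ('v, 'a) qpath" where
  "rot_left Q c = (if snd c = [] then c else (head Q (hd (snd c)), tl (snd c) @ [hd (snd c)]))"

lemma rot_eq: "rot Q c = (tail Q (last (snd c)), last (snd c) # butlast (snd c))"
  by (simp add: rot_def pcomp_def but_last_def last_arrow_def arrow_def)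

lemma snd_rot_left: "snd (rot_left Q c) = rotate1 (snd c)"
  by (cases "snd c") (auto simp: rot_left_def)

text \<open>Recovers (\<alpha>, \<gamma>) from \<alpha>\<gamma> and the length m of \<gamma>. The
  arrows are listed in the order of traversal, so \<gamma> takes up the first m of them.\<close>

definition split_path :: "('v, 'a) pre_digraph \<Rightarrow> nat \<Rightarrow> ('v, 'a) qpath \<Rightarrow> ('v, 'a) qpath \<times> ('v, 'a) qpath" where
  "split_path Q m c = ((tgt Q (fst c, take m (snd c)), drop m (snd c)), (fst c, take m (snd c)))"

lemma pcomp_split_path: "fst (split_path Q m c) \<cdot> snd (split_path Q m c) = c"
  by (simp add: split_path_def pcomp_def)

lemma split_path_eq_iff [simp]: "split_path Q m c = split_path Q m c' \<longleftrightarrow> c = c'"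
  by (metis pcomp_split_path)

text \<open>The adjacent pairs of the square are those of the word together with the pair closing it
  up, and this cyclic set of pairs does not depend on the starting point.\<close>

lemma successively_square_rotate1:
  "successively P (xs @ xs) \<Longrightarrow> successively P (rotate1 xs @ rotate1 xs)"
  by (cases xs) (auto simp: successively_append_iff successively_Cons hd_append split: if_splits)

lemma successively_square_rotate_right:
  "\<lbrakk>successively P (xs @ xs); xs \<noteq> []\<rbrakk> \<Longrightarrow>
    successively P (last xs # butlast xs @ last xs # butlast xs)"
  by (cases xs rule: rev_cases)
    (auto simp: successively_append_iff successively_Cons hd_append split: if_splits)

lemma successively_take: "successively P xs \<Longrightarrow> successively P (take n xs)"
  and successively_drop: "successively P xs \<Longrightarrow> successively P (drop n xs)"
  using successively_append_iff[of P "take n xs" "drop n xs"] by simp_all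

context quadratic_monomial_presentation
begin

lemma in_closed_paths_iff:
  "c \<in> closed_paths Q \<longleftrightarrow> c \<in> qpaths Q \<and>
    (snd c = [] \<or> tail Q (hd (snd c)) = fst c \<and> head Q (last (snd c)) = fst c)"
  by (auto simp: closed_paths_def src_def tgt_eq in_qpaths_iff)

lemma in_qcycles_iff: "c \<in> qcycles Q \<longleftrightarrow> c \<in> closed_paths Q \<and> snd c \<noteq> []"
  by (auto simp: qcycles_def closed_paths_def plength_def)

lemma rot_left_closed: "c \<in> closed_paths Q \<Longrightarrow> rot_left Q c \<in> closed_paths Q"
  by (cases c; cases "snd c")
    (auto simp: in_closed_paths_iff in_qpaths_iff rot_left_def successively_append_iff successively_Cons
      hd_append split: if_splits)

lemma rot_right_closed: "c \<in> closed_paths Q \<Longrightarrow> rot_right Q c \<in> closed_paths Q"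
  by (cases c; cases "snd c" rule: rev_cases)
    (auto simp: in_closed_paths_iff in_qpaths_iff rot_right_def rot_eq successively_append_iff
      successively_Cons hd_append split: if_splits)

lemma rot_right_left: "c \<in> closed_paths Q \<Longrightarrow> rot_right Q (rot_left Q c) = c"
  by (cases c) (auto simp: in_closed_paths_iff rot_left_def rot_right_def rot_eq)

lemma rot_left_right: "c \<in> closed_paths Q \<Longrightarrow> rot_left Q (rot_right Q c) = c"
  by (cases c) (auto simp: in_closed_paths_iff rot_left_def rot_right_def rot_eq)

lemma rot_right_funpow_closed: "c \<in> closed_paths Q \<Longrightarrow> (rot_right Q ^^ n) c \<in> closed_paths Q"
  by (induction n) (auto simp: rot_right_closed)

text \<open>The inverse rotation acts on the arrows as \<open>rotate1\<close>, whose power by the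
  length is the identity; the source of a path of positive length is determined by its arrows.
  Undoing these rotations gives the claim.\<close>

lemma rot_right_funpow_eq_self:
  assumes "c \<in> closed_paths Q"
  shows "(rot_right Q ^^ length (snd c)) c = c"
proof -
  have closed: "(rot_left Q ^^ n) c \<in> closed_paths Q" for n
    using assms by (induction n) (auto simp: rot_left_closed)
  have right_left: "(rot_right Q ^^ n) ((rot_left Q ^^ n) c) = c" for n
  proof (induction n)
    case (Suc n)
    have "(rot_right Q ^^ Suc n) ((rot_left Q ^^ Suc n) c) =
        (rot_right Q ^^ n) (rot_right Q (rot_left Q ((rot_left Q ^^ n) c)))"
      by (subst funpow_Suc_right) simp
    then show ?case
      using Suc closed[of n] by (simp add: rot_right_left)
  qed simp
  have "snd ((rot_left Q ^^ n) c) = rotate n (snd c)" for n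
    by (induction n) (auto simp: snd_rot_left)
  then have snd: "snd ((rot_left Q ^^ length (snd c)) c) = snd c"
    by simp
  have "(rot_left Q ^^ length (snd c)) c = c"
  proof (cases "snd c = []")
    case False
    then have "fst ((rot_left Q ^^ length (snd c)) c) = fst c"
      using snd assms closed[of "length (snd c)"] by (simp add: in_closed_paths_iff)
    then show ?thesis
      using snd by (simp add: prod_eq_iff)
  qed simp
  then show ?thesis
    using right_left[of "length (snd c)"] by simp
qed

lemma rot_right_pos_period:
  assumes "c \<in> closed_paths Q"
  obtains n where "n > 0" "(rot_right Q ^^ n) c = c"
proof (cases "snd c = []")
  case True
  \<comment> \<open>The length of a vertex is 0, so it does not provide a positive exponent.\<close>
  then have "(rot_right Q ^^ 1) c = c"
    by (simp add: rot_right_def)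
  then show thesis
    using that zero_less_one by blast
next
  case False
  then show thesis
    using that rot_right_funpow_eq_self[OF assms] by blast
qed


section \<open>The basis of the complex\<close>

text \<open>The pair formed by the arrows m and m + 1, at the junction of \<gamma> and \<alpha>, is
  left free, and so is the pair that closes the path.\<close>

definition admissible :: "nat \<Rightarrow> ('v, 'a) qpath set" where
  "admissible m = {c \<in> closed_paths Q. m \<le> length (snd c) \<and> successively rel (take m (snd c)) \<and>
     successively (\<lambda>a b. \<not> rel a b) (drop m (snd c))}"

lemma admissible_closed: "c \<in> admissible m \<Longrightarrow> c \<in> closed_paths Q"
  by (simp add: admissible_def)

lemma split_path_in_qpaths:
  assumes "c \<in> closed_paths Q"
  shows "fst (split_path Q m c) \<in> qpaths Q" "snd (split_path Q m c) \<in> qpaths Q"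
proof -
  have "src (fst (split_path Q m c)) = tgt Q (snd (split_path Q m c))"
    by (simp add: split_path_def src_def)
  then show "fst (split_path Q m c) \<in> qpaths Q" "snd (split_path Q m c) \<in> qpaths Q"
    using pcomp_in_qpaths_iff[of "fst (split_path Q m c)" "snd (split_path Q m c)"] assms
    by (auto simp: pcomp_split_path closed_paths_def)
qed

lemma BGamma_eq: "BGamma Q R m = split_path Q m ` admissible m"
proof (intro equalityI subsetI)
  fix p assume "p \<in> BGamma Q R m"
  then obtain \<alpha> \<gamma> where p: "p = (\<alpha>, \<gamma>)" "\<alpha> \<in> \<B> Q R" "\<gamma> \<in> \<Gamma> Q R" "plength \<gamma> = m"
    "src \<alpha> = tgt Q \<gamma>" "tgt Q \<alpha> = src \<gamma>"
    by (auto simp: BGamma_def)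
  then have "p = split_path Q m (\<alpha> \<cdot> \<gamma>)"
    by (auto simp: split_path_def pcomp_def plength_def src_def prod_eq_iff)
  moreover have "\<alpha> \<cdot> \<gamma> \<in> closed_paths Q"
    using p by (auto simp: closed_paths_def tgt_pcomp pcomp_in_qpaths_iff in_B_iff in_Gamma_iff)
  then have "\<alpha> \<cdot> \<gamma> \<in> admissible m"
    using p by (auto simp: admissible_def in_B_iff in_Gamma_iff pcomp_def plength_def)
  ultimately show "p \<in> split_path Q m ` admissible m"
    by blast
next
  fix p assume "p \<in> split_path Q m ` admissible m"
  then obtain c where c: "c \<in> admissible m" and p: "p = split_path Q m c"
    by blast
  have src: "src (fst p) = tgt Q (snd p)"
    by (simp add: p split_path_def src_def)
  moreover have "tgt Q (fst p) = src (snd p)"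
    using tgt_pcomp[OF src] c src_pcomp[of "fst p" "snd p"]
    by (simp add: p pcomp_split_path admissible_def closed_paths_def)
  ultimately show "p \<in> BGamma Q R m"
    using c split_path_in_qpaths[of c m] by (auto simp: BGamma_def in_B_iff in_Gamma_iff p admissible_def)
      (auto simp: split_path_def plength_def)
qed

text \<open>The pair at the junction of \<gamma> and \<alpha> decides. If it is related, the first
  arrow of \<alpha> can be added to \<gamma>; if not, the last arrow of \<gamma> can be added to
  \<alpha>. Without a junction only one move exists and it always succeeds: upwards for m = 0,
  downwards if \<alpha> is a vertex.\<close>

lemma admissible_Suc_iff:
  assumes "c \<in> admissible m" "snd c \<noteq> []"
  shows "c \<in> admissible (Suc m) \<longleftrightarrow> \<not> (\<exists>k. m = Suc k \<and> c \<in> admissible k)"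
proof (cases m)
  case 0
  then show ?thesis
    using assms by (cases "snd c") (auto simp: admissible_def successively_Cons)
next
  case (Suc k)
  obtain xs ys where cs: "snd c = xs @ ys" "length xs = m"
    using assms(1) by (metis (mono_tags, lifting) admissible_def append_take_drop_id length_take mem_Collect_eq min.absorb2)
  then obtain us a where xs: "xs = us @ [a]" "length us = k"
    using Suc by (cases xs rule: rev_cases) auto
  have "(\<exists>k. m = Suc k \<and> c \<in> admissible k) \<longleftrightarrow> c \<in> admissible k"
    using Suc by simp
  then show ?thesis
    using assms cs xs Suc
    by (cases ys) (auto simp: admissible_def successively_append_iff successively_Cons)
qed

lemma empty_in_admissible: "\<lbrakk>c \<in> admissible m; snd c = []\<rbrakk> \<Longrightarrow> m = 0"
  by (simp add: admissible_def)

definition steady :: "nat \<Rightarrow> ('v, 'a) qpath set" where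
  "steady m = {c \<in> admissible m \<inter> admissible (Suc m). rot_left Q c \<in> admissible m \<inter> admissible (Suc m)}"

lemma steady_iff:
  "c \<in> steady m \<longleftrightarrow> c \<in> qcycles Q \<and>
    (successively rel (snd c @ snd c) \<and> length (snd c) = Suc m \<or>
     successively (\<lambda>a b. \<not> rel a b) (snd c @ snd c) \<and> m = 0)"
proof
  assume c: "c \<in> steady m"
  then have cycle: "c \<in> qcycles Q"
    by (auto simp: steady_def admissible_def in_qcycles_iff)
  obtain a us where cs: "snd c = a # us"
    using cycle by (cases "snd c") (auto simp: in_qcycles_iff)
  show "c \<in> qcycles Q \<and>
    (successively rel (snd c @ snd c) \<and> length (snd c) = Suc m \<or>
     successively (\<lambda>a b. \<not> rel a b) (snd c @ snd c) \<and> m = 0)"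
  proof (cases m)
    case 0
    then have "successively (\<lambda>a b. \<not> rel a b) (a # us)" "successively (\<lambda>a b. \<not> rel a b) (us @ [a])"
      using c cs by (auto simp: steady_def admissible_def snd_rot_left)
    \<comment> \<open>A loop has no adjacent pair to test: whether \<open>rel a a\<close> holds
      decides between the two alternatives.\<close>
    then show ?thesis
      using cycle 0 cs
        by (cases us) (auto simp: successively_append_iff successively_Cons hd_append split: if_splits)
  next
    case (Suc k)
    have "length us = m"
    proof (rule ccontr)
      assume "length us \<noteq> m"
      moreover have "m \<le> length us"
        using c cs by (simp add: steady_def admissible_def)
      \<comment> \<open>These are the arrows m + 1 and m + 2 of c. They belong to \<alpha> when c is
        split in degree m, and to \<gamma> when the rotated path is split in degree m + 1.\<close>
      ultimately obtain vs b d ws where us: "us = vs @ b # d # ws" "length vs = k"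
        using Suc by (metis (no_types, opaque_lifting) Cons_nth_drop_Suc Suc_leD Suc_le_eq append_take_drop_id
            le_neq_implies_less length_take min.absorb2)
      have "\<not> rel b d"
        using c cs us Suc by (auto simp: steady_def admissible_def)
      moreover have "rel b d"
        using c cs us Suc by (auto simp: steady_def admissible_def snd_rot_left successively_append_iff)
      ultimately show False
        by contradiction
    qed
    then have "successively rel (a # us)" "successively rel (us @ [a])"
      using c cs by (auto simp: steady_def admissible_def snd_rot_left)
    then show ?thesis
      using cycle cs Suc \<open>length us = m\<close> 
      by (cases us) (auto simp: successively_append_iff successively_Cons hd_append split: if_splits)
  qed
next
  assume *: "c \<in> qcycles Q \<and>
    (successively rel (snd c @ snd c) \<and> length (snd c) = Suc m \<or>
     successively (\<lambda>a b. \<not> rel a b) (snd c @ snd c) \<and> m = 0)"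
  have admissible: "c' \<in> admissible m \<inter> admissible (Suc m)"
    if "c' \<in> qcycles Q" "successively rel (snd c' @ snd c') \<and> length (snd c') = Suc m \<or>
     successively (\<lambda>a b. \<not> rel a b) (snd c' @ snd c') \<and> m = 0" for c'
    using that(2)
  proof (elim disjE conjE)
    assume "successively rel (snd c' @ snd c')" "length (snd c') = Suc m"
    moreover from this obtain xs a where "snd c' = xs @ [a]" "length xs = m"
      by (cases "snd c'" rule: rev_cases) auto
    ultimately show ?thesis
      using that(1) by (auto simp: admissible_def in_qcycles_iff successively_append_iff)
  next
    assume "successively (\<lambda>a b. \<not> rel a b) (snd c' @ snd c')" "m = 0"
    then show ?thesis
      using that(1) by (cases "snd c'") (auto simp: admissible_def in_qcycles_iff successively_append_iff successively_Cons)
  qed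
  have "rot_left Q c \<in> qcycles Q"
    using * by (auto simp: in_qcycles_iff rot_left_closed snd_rot_left)
  then show "c \<in> steady m"
    using * admissible[of c] admissible[of "rot_left Q c"] successively_square_rotate1[of _ "snd c"]
    by (auto simp: steady_def snd_rot_left)
qed

lemma steady_closed: "c \<in> steady m \<Longrightarrow> c \<in> closed_paths Q"
  by (auto simp: steady_def intro: admissible_closed)

lemma steady_nonempty: "c \<in> steady m \<Longrightarrow> snd c \<noteq> []"
  by (simp add: steady_iff in_qcycles_iff)

lemma rot_left_steady: "c \<in> steady m \<Longrightarrow> rot_left Q c \<in> steady m"
  by (auto simp: steady_iff in_qcycles_iff rot_left_closed snd_rot_left
      intro: successively_square_rotate1)

lemma rot_right_steady: "c \<in> steady m \<Longrightarrow> rot_right Q c \<in> steady m"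
  by (auto simp: steady_iff in_qcycles_iff rot_right_closed)
    (auto simp: rot_right_def rot_eq dest: successively_square_rotate_right)

lemma rot_right_funpow_steady: "c \<in> steady m \<Longrightarrow> (rot_right Q ^^ n) c \<in> steady m"
  by (induction n) (auto simp: rot_right_steady)


section \<open>The differential\<close>

definition basis_chain :: "nat \<Rightarrow> ('v, 'a) qpath \<Rightarrow> ('v, 'a, 'k::field) chain" where
  "basis_chain m c = (if c \<in> admissible m then Poly_Mapping.single (split_path Q m c) 1 else 0)"

definition coef :: "nat \<Rightarrow> ('v, 'a, 'k::field) chain \<Rightarrow> ('v, 'a) qpath \<Rightarrow> 'k" where
  "coef m x c = Poly_Mapping.lookup x (split_path Q m c)"

lemma coef_zero [simp]: "coef m 0 c = 0"
  and coef_add: "coef m (x + y) c = coef m x c + coef m y c"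
  and coef_scale [simp]: "coef m (scale a x) c = a * coef m x c"
  and coef_sum: "coef m (sum f S) c = (\<Sum>i\<in>S. coef m (f i) c)"
  by (simp_all add: coef_def lookup_add lookup_sum)

lemma coef_basis_chain: "coef m (basis_chain m c) c' = (if c \<in> admissible m \<and> c' = c then 1 else 0)"
  by (auto simp: coef_def basis_chain_def lookup_single when_def)

lemma coef_eq_zero: "\<lbrakk>x \<in> chains Q R m; c \<notin> admissible m\<rbrakk> \<Longrightarrow> coef m x c = 0"
  by (auto simp: coef_def chains_def BGamma_eq in_keys_iff)

lemma basis_chain_not_admissible: "c \<notin> admissible m \<Longrightarrow> basis_chain m c = 0"
  by (simp add: basis_chain_def)

lemma basis_chain_in_chains: "basis_chain m c \<in> chains Q R m"
  by (simp add: basis_chain_def chains_def BGamma_eq)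

lemma chains_zero: "0 \<in> chains Q R m"
  and chains_add: "\<lbrakk>x \<in> chains Q R m; y \<in> chains Q R m\<rbrakk> \<Longrightarrow> x + y \<in> chains Q R m"
  and chains_minus: "\<lbrakk>x \<in> chains Q R m; y \<in> chains Q R m\<rbrakk> \<Longrightarrow> x - y \<in> chains Q R m"
  and chains_scale: "x \<in> chains Q R m \<Longrightarrow> scale a x \<in> chains Q R m"
  using keys_add[of x y] keys_diff[of x y] keys_scale_subset[of a x] by (auto simp: chains_def)

lemma chains_lin_ext:
  assumes "\<And>b. b \<in> Poly_Mapping.keys x \<Longrightarrow> f b \<in> chains Q R m"
  shows "lin_ext f x \<in> chains Q R m"
  using assms keys_lin_ext_subset[of f x] by (fastforce simp: chains_def)

lemma chains_sum: "(\<And>i. i \<in> S \<Longrightarrow> f i \<in> chains Q R m) \<Longrightarrow> sum f S \<in> chains Q R m"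
  by (induction S rule: infinite_finite_induct) (auto simp: chains_add chains_zero)

lemma chains_cases:
  assumes "x \<in> chains Q R m" "p \<in> Poly_Mapping.keys x"
  obtains c where "c \<in> admissible m" "p = split_path Q m c"
  using assms by (auto simp: chains_def BGamma_eq)

lemma pair_mod_split_path:
  assumes "c \<in> closed_paths Q" "m \<le> length (snd c)" "successively rel (take m (snd c))"
  shows "pair_mod Q R (fst (split_path Q m c)) (snd (split_path Q m c)) = basis_chain m c"
proof -
  have "fst (split_path Q m c) \<in> \<B> Q R \<longleftrightarrow> c \<in> admissible m"
    using assms split_path_in_qpaths[of c m] by (auto simp: in_B_iff admissible_def) (auto simp: split_path_def)
  then show ?thesis
    using assms split_path_in_qpaths[of c m]
    by (auto simp: pair_mod_def single_in_pres_ideal_iff basis_chain_def pair_def)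
qed

text \<open>Handing the last arrow of \<gamma> to \<alpha> only shifts the place of splitting, while
  handing over its first arrow passes the base point and thus rotates. What remains of \<gamma>
  stays in \<Gamma>, so a term vanishes only through its first component, as the value 0 of
  \<open>basis_chain\<close> expresses.\<close>

lemma bdry_pair_split_path:
  assumes "c \<in> admissible (Suc m)"
  shows "bdry_pair Q R (Suc m) (fst (split_path Q (Suc m) c)) (snd (split_path Q (Suc m) c)) =
    basis_chain m c + scale ((-1) ^ Suc m) (basis_chain m (rot_left Q c))"
proof -
  let ?\<alpha> = "fst (split_path Q (Suc m) c)" and ?\<gamma> = "snd (split_path Q (Suc m) c)"
  obtain xs a zs where xs: "snd c = xs @ a # zs" "length xs = m"
    using assms that[of "take m (snd c)" "snd c ! m" "drop (Suc m) (snd c)"]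
    by (auto simp: admissible_def Suc_le_eq id_take_nth_drop)
  have closed: "c \<in> closed_paths Q"
    using assms by (rule admissible_closed)
  have "successively (\<lambda>a b. head Q a = tail Q b) (snd c)" "tail Q (hd (snd c)) = fst c"
    using closed xs(1) by (auto simp: closed_paths_def in_qpaths_iff)
  then have 1: "?\<alpha> \<cdot> last_arrow Q ?\<gamma> = fst (split_path Q m c)"
      "but_last ?\<gamma> = snd (split_path Q m c)"
    using xs by (auto simp: split_path_def pcomp_def last_arrow_def but_last_def arrow_def tgt_eq
        butlast_append successively_append_iff)
  have 2: "pair_mod Q R (fst (split_path Q m c)) (snd (split_path Q m c)) = basis_chain m c"
    using assms xs by (intro pair_mod_split_path) (auto simp: admissible_def successively_append_iff)
  have 3: "first_arrow Q ?\<gamma> \<cdot> ?\<alpha> = fst (split_path Q m (rot_left Q c))"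
      "but_first Q ?\<gamma> = snd (split_path Q m (rot_left Q c))"
    using xs by (cases xs;
      auto simp: split_path_def pcomp_def first_arrow_def but_first_def arrow_def tgt_eq rot_left_def)+
  have 4: "pair_mod Q R (fst (split_path Q m (rot_left Q c))) (snd (split_path Q m (rot_left Q c))) =
      basis_chain m (rot_left Q c)"
  proof (rule pair_mod_split_path)
    show "successively rel (take m (snd (rot_left Q c)))"
      using assms xs by (cases xs) (auto simp: admissible_def snd_rot_left successively_Cons)
  qed (use closed xs in \<open>auto simp: rot_left_closed snd_rot_left\<close>)
  show ?thesis
    by (simp only: bdry_pair_def 1 2 3 4)
qed

lemma bdry_zero_degree [simp]: "bdry Q R 0 x = 0"
  by (simp add: bdry_def)

lemma bdry_Suc: "bdry Q R (Suc m) x = lin_ext (\<lambda>p. bdry_pair Q R (Suc m) (fst p) (snd p)) x"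
  by (simp add: bdry_def lin_ext_def case_prod_unfold)

lemma bdry_zero [simp]: "bdry Q R m 0 = 0"
  and bdry_add: "bdry Q R m (x + y) = bdry Q R m x + bdry Q R m y"
  and bdry_minus: "bdry Q R m (x - y) = bdry Q R m x - bdry Q R m y"
  and bdry_scale: "bdry Q R m (scale a x) = scale a (bdry Q R m x)"
  and bdry_sum: "bdry Q R m (sum f S) = (\<Sum>i\<in>S. bdry Q R m (f i))"
  by (cases m; simp add: bdry_Suc lin_ext_add lin_ext_minus lin_ext_scale lin_ext_sum)+

lemma bdry_lin_ext: "bdry Q R m (lin_ext f x) = lin_ext (\<lambda>b. bdry Q R m (f b)) x"
  by (cases m) (simp_all only: bdry_Suc bdry_zero_degree lin_ext_comp lin_ext_zero_fun)

lemma bdry_basis_chain: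
  "bdry Q R (Suc m) (basis_chain (Suc m) c) =
    (if c \<in> admissible (Suc m) then basis_chain m c + scale ((-1) ^ Suc m) (basis_chain m (rot_left Q c)) else 0)"
  using bdry_pair_split_path[of c m] by (auto simp: basis_chain_def[of "Suc m"] bdry_Suc)

lemma bdry_eq_lin_ext:
  assumes "x \<in> chains Q R (Suc m)"
  shows "bdry Q R (Suc m) x = lin_ext (\<lambda>p. bdry Q R (Suc m) (basis_chain (Suc m) (fst p \<cdot> snd p))) x"
  unfolding bdry_Suc[of m x]
proof (rule lin_ext_cong)
  fix p assume "p \<in> Poly_Mapping.keys x"
  then obtain c where "c \<in> admissible (Suc m)" "p = split_path Q (Suc m) c"
    using assms chains_cases by blast
  then show "bdry_pair Q R (Suc m) (fst p) (snd p) =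
      (bdry Q R (Suc m) (basis_chain (Suc m) (fst p \<cdot> snd p)) :: ('v, 'a, 'b) chain)"
    by (simp add: bdry_pair_split_path pcomp_split_path bdry_basis_chain)
qed

lemma chain_eq_lin_ext:
  assumes "x \<in> chains Q R m"
  shows "x = lin_ext (\<lambda>p. basis_chain m (fst p \<cdot> snd p)) x"
proof -
  have "lin_ext (\<lambda>p. basis_chain m (fst p \<cdot> snd p)) x = lin_ext (\<lambda>p. Poly_Mapping.single p 1) x"
    using chains_cases[OF assms] by (intro lin_ext_cong) (metis basis_chain_def pcomp_split_path)
  then show ?thesis
    by simp
qed

lemma bdry_in_chains: "bdry Q R (Suc m) x \<in> chains Q R m" if "x \<in> chains Q R (Suc m)"
  unfolding bdry_eq_lin_ext[OF that] bdry_basis_chain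
  by (intro chains_lin_ext) (auto intro!: chains_add chains_scale basis_chain_in_chains chains_zero)

text \<open>Transpose of the formula on basis elements: c occurs in the boundary of c itself and of
  the path whose left rotation is c, hence the right rotation here.\<close>

lemma coef_bdry:
  fixes x :: "('v, 'a, 'k::field) chain"
  assumes x: "x \<in> chains Q R (Suc m)" and c: "c \<in> admissible m"
  shows "coef m (bdry Q R (Suc m) x) c =
    coef (Suc m) x c + (-1) ^ Suc m * coef (Suc m) x (rot_right Q c)"
proof -
  let ?p = "split_path Q (Suc m) c" and ?q = "split_path Q (Suc m) (rot_right Q c)"
  have "coef m (bdry Q R (Suc m) x) c =
      (\<Sum>p\<in>Poly_Mapping.keys x. Poly_Mapping.lookup x p * coef m (bdry Q R (Suc m) (basis_chain (Suc m) (fst p \<cdot> snd p))) c)"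
    by (simp add: bdry_eq_lin_ext[OF x] coef_def lookup_lin_ext)
  \<comment> \<open>The two indicators are added, not nested, because rotation may fix c, as for a
    loop; then both terms contribute to the same coefficient.\<close>
  also have "\<dots> = (\<Sum>p\<in>Poly_Mapping.keys x. (if p = ?p then Poly_Mapping.lookup x p else 0) +
      (if p = ?q then (-1) ^ Suc m * Poly_Mapping.lookup x p else 0))"
  proof (rule sum.cong)
    fix p assume "p \<in> Poly_Mapping.keys x"
    then obtain c' where c': "c' \<in> admissible (Suc m)" "p = split_path Q (Suc m) c'"
      using x chains_cases by blast
    then have "rot_left Q c' = c \<longleftrightarrow> c' = rot_right Q c"
      using c rot_left_right[of c] rot_right_left[of c'] by (auto dest: admissible_closed)
    then show "Poly_Mapping.lookup x p * coef m (bdry Q R (Suc m) (basis_chain (Suc m) (fst p \<cdot> snd p))) c =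
      (if p = ?p then Poly_Mapping.lookup x p else 0) + (if p = ?q then (-1) ^ Suc m * Poly_Mapping.lookup x p else 0)"
      using c c' by (auto simp: pcomp_split_path bdry_basis_chain coef_add coef_basis_chain algebra_simps)
  qed simp
  also have "\<dots> = coef (Suc m) x c + (-1) ^ Suc m * coef (Suc m) x (rot_right Q c)"
    by (auto simp: sum.distrib coef_def in_keys_iff)
  finally show ?thesis .
qed

text \<open>Of the four terms the two outer ones vanish: c already occupies the degrees m and m + 1,
  and the twice rotated path has a related pair in its \<alpha>. The two middle terms are the same
  basis element with opposite signs, and if it is nonzero then both intermediate terms are present,
  so they cancel.\<close>

lemma bdry_bdry:
  assumes x: "x \<in> chains Q R (Suc m)"
  shows "bdry Q R m (bdry Q R (Suc m) x) = 0"
proof (cases m)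
  case (Suc k)
  have "bdry Q R m (bdry Q R (Suc m) (basis_chain (Suc m) c)) = (0 :: ('v, 'a, 'b) chain)" for c
  proof (cases "c \<in> admissible (Suc m)")
    case True
    let ?c = "rot_left Q c"
    obtain a b us where cs: "snd c = a # b # us"
      using True Suc by (cases "snd c"; cases "tl (snd c)") (auto simp: admissible_def)
    have 1: "basis_chain k c = (0 :: ('v, 'a, 'b) chain)" if "c \<in> admissible m"
      using admissible_Suc_iff[of c m] True that cs Suc by (auto simp: basis_chain_def)
    have 2: "c \<in> admissible m \<and> ?c \<in> admissible m" if "?c \<in> admissible k"
    proof -
      have "successively rel (take (Suc k) (snd c))"
        using True Suc successively_take[of rel "take (Suc m) (snd c)" "Suc k"] by (simp add: admissible_def)
      moreover have "successively rel (b # take k us)" "k \<le> length us"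
        using True cs Suc by (auto simp: admissible_def)
      moreover have "successively (\<lambda>a b. \<not> rel a b) (drop k (b # us) @ [a])"
        using that cs \<open>k \<le> length us\<close> drop_append[of k "b # us" "[a]"] by (simp add: admissible_def snd_rot_left)
      then have "successively (\<lambda>a b. \<not> rel a b) (drop k (b # us))"
        "successively (\<lambda>a b. \<not> rel a b) (drop k us @ [a])"
        using successively_drop[of "\<lambda>a b. \<not> rel a b" "drop k (b # us) @ [a]" 1] \<open>k \<le> length us\<close>
        by (simp_all add: successively_append_iff)
      ultimately show ?thesis
        using cs Suc admissible_closed[OF True] by (simp add: admissible_def snd_rot_left rot_left_closed)
    qed
    \<comment> \<open>The arrows a and b open \<gamma> and so are related; after two rotations they
      end the path and lie in its \<alpha>.\<close>
    have 3: "basis_chain k (rot_left Q ?c) = (0 :: ('v, 'a, 'b) chain)"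
      using True cs Suc by (auto simp: basis_chain_def admissible_def snd_rot_left successively_append_iff)
    have 4: "basis_chain k ?c = (0 :: ('v, 'a, 'b) chain)" if "?c \<notin> admissible k"
      using that by (rule basis_chain_not_admissible)
    show ?thesis
      using True 1 2 3 4
      by (cases "?c \<in> admissible k") (auto simp: bdry_basis_chain bdry_add bdry_scale Suc scale_minus_left)
  qed (simp add: bdry_basis_chain)
  then show ?thesis
    by (subst bdry_eq_lin_ext[OF x]) (simp only: bdry_lin_ext lin_ext_zero_fun)
qed simp


section \<open>Reduction to complete and cocomplete cycles\<close>

text \<open>The steady paths carry two-term complexes: those of index \<open>k\<close> span the upper term, in degree
  \<open>k + 1\<close>, and the lower term, in degree \<open>k\<close>. A vertex has a lower term only.\<close>

definition upper_cycles :: "nat \<Rightarrow> ('v, 'a) qpath set" where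
  "upper_cycles m = {c. \<exists>k. m = Suc k \<and> c \<in> steady k}"

definition lower_cycles :: "nat \<Rightarrow> ('v, 'a) qpath set" where
  "lower_cycles m = steady m \<union> {c \<in> admissible m. snd c = []}"

lemma upper_admissible: "c \<in> upper_cycles m \<Longrightarrow> c \<in> admissible m"
  and lower_admissible: "c \<in> lower_cycles m \<Longrightarrow> c \<in> admissible m"
  by (auto simp: upper_cycles_def lower_cycles_def steady_def)

lemma rot_left_upper: "c \<in> upper_cycles m \<Longrightarrow> rot_left Q c \<in> upper_cycles m"
  and rot_left_lower: "c \<in> lower_cycles m \<Longrightarrow> rot_left Q c \<in> lower_cycles m"
  by (auto simp: upper_cycles_def lower_cycles_def rot_left_steady) (auto simp: rot_left_def)

lemma rot_right_upper: "c \<in> upper_cycles m \<Longrightarrow> rot_right Q c \<in> upper_cycles m"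
  and rot_right_lower: "c \<in> lower_cycles m \<Longrightarrow> rot_right Q c \<in> lower_cycles m"
  by (auto simp: upper_cycles_def lower_cycles_def rot_right_steady) (auto simp: rot_right_def)

lemma rot_right_funpow_upper: "c \<in> upper_cycles m \<Longrightarrow> (rot_right Q ^^ n) c \<in> upper_cycles m"
  and rot_right_funpow_lower: "c \<in> lower_cycles m \<Longrightarrow> (rot_right Q ^^ n) c \<in> lower_cycles m"
  by (induction n) (auto simp: rot_right_upper rot_right_lower)

lemma upper_not_admissible_Suc: "c \<in> upper_cycles m \<Longrightarrow> c \<notin> admissible (Suc m)"
  using admissible_Suc_iff[of c m] by (auto simp: upper_cycles_def steady_def dest: empty_in_admissible)

lemma upper_lower_disjoint: "c \<in> upper_cycles m \<Longrightarrow> c \<notin> lower_cycles m"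
  using upper_not_admissible_Suc[of c m] by (auto simp: lower_cycles_def steady_def upper_cycles_def dest: empty_in_admissible)

definition homotopy :: "nat \<Rightarrow> ('v, 'a, 'k::field) chain \<Rightarrow> ('v, 'a, 'k) chain" where
  "homotopy m x = lin_ext (\<lambda>p. basis_chain (Suc m) (fst p \<cdot> snd p)) x"

lemma homotopy_basis_chain: "homotopy m (basis_chain m c) = (if c \<in> admissible m then basis_chain (Suc m) c else 0)"
  by (simp add: homotopy_def basis_chain_def[of m] pcomp_split_path)

text \<open>The value of 1 - ds - sd. On upper cycles the rotated term comes from sd and carries the
  negated sign of the differential in degree m, on lower cycles it comes from ds and carries that of
  degree m + 1. For a vertex m = 0, so the sign is 1.\<close>

definition collapse :: "nat \<Rightarrow> ('v, 'a) qpath \<Rightarrow> ('v, 'a, 'k::field) chain" where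
  "collapse m c =
    (if c \<in> upper_cycles m then scale ((-1) ^ Suc m) (basis_chain m (rot_left Q c))
     else if c \<in> lower_cycles m then scale ((-1) ^ m) (basis_chain m (rot_left Q c))
     else 0)"

lemma rot_left_eq_Nil_iff [simp]: "snd (rot_left Q c) = [] \<longleftrightarrow> snd c = []"
  by (simp add: snd_rot_left)

lemma collapse_zero:
  assumes "c \<in> admissible 0"
  shows "basis_chain 0 c - bdry Q R (Suc 0) (basis_chain (Suc 0) c) = collapse 0 c"
proof (cases "snd c = []")
  case True
  then show ?thesis
    using assms by (auto simp: collapse_def upper_cycles_def lower_cycles_def rot_left_def bdry_basis_chain
        basis_chain_not_admissible dest: empty_in_admissible)
next
  case False
  then show ?thesis
    using assms admissible_Suc_iff[of c 0] admissible_Suc_iff[of "rot_left Q c" 0]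
    by (auto simp: collapse_def upper_cycles_def lower_cycles_def bdry_basis_chain steady_def
        basis_chain_not_admissible scale_minus_left)
qed

text \<open>If the second degree of c is k, then ds vanishes on c, and a rotated term survives in sd
  only when the rotated path also occupies k and k + 1. If it is k + 2 and the rotated path, where
  admissible, goes down to k instead, then ds and sd both produce the rotated term, with opposite
  signs. The unrotated term cancels c in all cases.\<close>

lemma collapse_Suc:
  assumes "c \<in> admissible (Suc k)"
  shows "basis_chain (Suc k) c - bdry Q R (Suc (Suc k)) (basis_chain (Suc (Suc k)) c) -
      homotopy k (bdry Q R (Suc k) (basis_chain (Suc k) c)) =
    collapse (Suc k) c"
proof -
  have ne: "snd c \<noteq> []" "snd (rot_left Q c) \<noteq> []"
    using assms by (auto dest: empty_in_admissible)
  have homotopy: "homotopy k (bdry Q R (Suc k) (basis_chain (Suc k) c)) =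
      (if c \<in> admissible k then basis_chain (Suc k) c else 0) +
      scale ((-1) ^ Suc k) (if rot_left Q c \<in> admissible k then basis_chain (Suc k) (rot_left Q c) else 0)"
    using assms unfolding homotopy_basis_chain[symmetric]
    by (simp add: bdry_basis_chain homotopy_def lin_ext_add lin_ext_scale)
  show ?thesis
    using assms admissible_Suc_iff[of c "Suc k"] admissible_Suc_iff[of "rot_left Q c" "Suc k"] ne
    unfolding homotopy
    by (auto simp: collapse_def upper_cycles_def lower_cycles_def bdry_basis_chain steady_def
        basis_chain_not_admissible scale_minus_left)
qed

section \<open>Boundaries, cycles and homology classes\<close>

lemma hboundariesI: "x \<in> chains Q R (Suc m) \<Longrightarrow> bdry Q R (Suc m) x \<in> hboundaries Q R m"
  by (simp add: hboundaries_def)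

lemma hboundaries_zero: "0 \<in> hboundaries Q R m"
  using hboundariesI[OF chains_zero] by simp

lemma hboundaries_add:
  "\<lbrakk>x \<in> hboundaries Q R m; y \<in> hboundaries Q R m\<rbrakk> \<Longrightarrow> x + y \<in> hboundaries Q R m"
  by (auto simp: hboundaries_def simp flip: bdry_add intro!: imageI chains_add)

lemma hboundaries_minus:
  "\<lbrakk>x \<in> hboundaries Q R m; y \<in> hboundaries Q R m\<rbrakk> \<Longrightarrow> x - y \<in> hboundaries Q R m"
  by (auto simp: hboundaries_def simp flip: bdry_minus intro!: imageI chains_minus)

lemma hboundaries_scale: "x \<in> hboundaries Q R m \<Longrightarrow> scale a x \<in> hboundaries Q R m"
  by (auto simp: hboundaries_def simp flip: bdry_scale intro!: imageI chains_scale)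

lemma hboundaries_in_hcycles: "x \<in> hboundaries Q R m \<Longrightarrow> x \<in> hcycles Q R m"
  by (auto simp: hboundaries_def hcycles_def bdry_in_chains bdry_bdry)

lemma hcycles_minus:
  "\<lbrakk>x \<in> hcycles Q R m; y \<in> hcycles Q R m\<rbrakk> \<Longrightarrow> x - y \<in> hcycles Q R m"
  by (auto simp: hcycles_def chains_minus bdry_minus)

lemma hcycles_scale: "x \<in> hcycles Q R m \<Longrightarrow> scale a x \<in> hcycles Q R m"
  by (auto simp: hcycles_def chains_scale bdry_scale)

lemma hclass_eq_iff: "hclass Q R m x = hclass Q R m y \<longleftrightarrow> x - y \<in> hboundaries Q R m"
proof
  assume "hclass Q R m x = hclass Q R m y"
  moreover have "x \<in> hclass Q R m x"
    unfolding hclass_def using hboundaries_zero by (intro image_eqI[of _ _ 0]) auto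
  ultimately show "x - y \<in> hboundaries Q R m"
    by (auto simp: hclass_def)
next
  assume xy: "x - y \<in> hboundaries Q R m"
  have "x + b \<in> hclass Q R m y" if "b \<in> hboundaries Q R m" for b
    unfolding hclass_def using hboundaries_add[OF xy that] by (intro image_eqI[of _ _ "x - y + b"]) auto
  moreover have "y + b \<in> hclass Q R m x" if "b \<in> hboundaries Q R m" for b
    unfolding hclass_def using hboundaries_minus[OF that xy] by (intro image_eqI[of _ _ "b - (x - y)"]) auto
  ultimately show "hclass Q R m x = hclass Q R m y"
    by (auto simp: hclass_def[of Q R m x] hclass_def[of Q R m y])
qed

text \<open>On a cycle the summand sd vanishes, so 1 - ds - sd changes it by a boundary. One
  application is enough, because upper and lower cycles are stable under rotation.\<close>

lemma homologous_to_steady: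
  fixes x :: "('v, 'a, 'k::field) chain"
  assumes x: "x \<in> hcycles Q R m"
  obtains y where "y \<in> hcycles Q R m" "x - y \<in> hboundaries Q R m"
    "Poly_Mapping.keys y \<subseteq> split_path Q m ` (upper_cycles m \<union> lower_cycles m)"
proof
  define y where "y = lin_ext (\<lambda>p. collapse m (fst p \<cdot> snd p)) x"
  have chain: "x \<in> chains Q R m" and cycle: "bdry Q R m x = 0"
    using x by (auto simp: hcycles_def)
  have "y = x - bdry Q R (Suc m) (homotopy m x)"
  proof (cases m)
    case 0
    have "y = lin_ext (\<lambda>p. basis_chain 0 (fst p \<cdot> snd p) - bdry Q R (Suc 0) (basis_chain (Suc 0) (fst p \<cdot> snd p))) x"
      unfolding y_def using chains_cases[OF chain]
      by (intro lin_ext_cong) (metis 0 collapse_zero pcomp_split_path)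
    then show ?thesis
      using chain_eq_lin_ext[OF chain] by (simp only: 0 lin_ext_minus_fun homotopy_def bdry_lin_ext)
  next
    case (Suc k)
    have "y = lin_ext (\<lambda>p. basis_chain m (fst p \<cdot> snd p) - bdry Q R (Suc m) (basis_chain (Suc m) (fst p \<cdot> snd p)) -
        homotopy k (bdry Q R m (basis_chain m (fst p \<cdot> snd p)))) x"
      unfolding y_def using chains_cases[OF chain]
      by (intro lin_ext_cong) (metis Suc collapse_Suc pcomp_split_path)
    also have "\<dots> = x - bdry Q R (Suc m) (homotopy m x) - homotopy k (bdry Q R m x)"
      using chain_eq_lin_ext[OF chain] bdry_eq_lin_ext[of x k] chain
      by (simp only: Suc lin_ext_minus_fun homotopy_def bdry_lin_ext lin_ext_comp)
    finally show ?thesis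
      by (simp add: cycle homotopy_def)
  qed
  moreover have "homotopy m x \<in> chains Q R (Suc m)"
    unfolding homotopy_def by (intro chains_lin_ext basis_chain_in_chains)
  ultimately show "x - y \<in> hboundaries Q R m"
    by (simp add: hboundariesI)
  then have "x - (x - y) \<in> hcycles Q R m"
    by (intro hcycles_minus hboundaries_in_hcycles x)
  then show "y \<in> hcycles Q R m"
    by simp
  have "Poly_Mapping.keys (scale a (basis_chain m d) :: ('v, 'a, 'k) chain) \<subseteq> split_path Q m ` (upper_cycles m \<union> lower_cycles m)"
    if "d \<in> upper_cycles m \<union> lower_cycles m" for a d
    using that by (intro order.trans[OF keys_scale_subset]) (auto simp: basis_chain_def)
  then have "Poly_Mapping.keys (collapse m c :: ('v, 'a, 'k) chain) \<subseteq> split_path Q m ` (upper_cycles m \<union> lower_cycles m)" for c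
    by (simp add: collapse_def rot_left_upper rot_left_lower)
  then show "Poly_Mapping.keys y \<subseteq> split_path Q m ` (upper_cycles m \<union> lower_cycles m)"
    unfolding y_def using keys_lin_ext_subset by fast
qed

text \<open>In positive degree c and its rotation both occupy degree m + 1 and hence not m - 1, so
  both terms of the boundary are 0.\<close>

lemma lower_basis_chain_cycle:
  assumes "c \<in> lower_cycles m"
  shows "basis_chain m c \<in> hcycles Q R m"
proof (cases m)
  case (Suc k)
  then have "c \<in> steady m" "rot_left Q c \<in> steady m"
    using assms by (auto simp: lower_cycles_def rot_left_steady dest: empty_in_admissible)
  then have "c \<notin> admissible k" "rot_left Q c \<notin> admissible k"
    using Suc admissible_Suc_iff[of c m] admissible_Suc_iff[of "rot_left Q c" m] steady_nonempty[of c m]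
    by (auto simp: steady_def)
  then show ?thesis
    by (simp add: hcycles_def basis_chain_in_chains Suc bdry_basis_chain basis_chain_not_admissible)
qed (simp add: hcycles_def basis_chain_in_chains)

lemma upper_sum_cycle:
  assumes c: "c \<in> upper_cycles m" and r: "(rot_right Q ^^ r) c = c" "(-1) ^ (Suc m * r) = (1::'k::field)"
  shows "(\<Sum>i<r. scale ((-1) ^ (Suc m * i)) (basis_chain m ((rot_right Q ^^ i) c)))
    \<in> (hcycles Q R m :: ('v, 'a, 'k) chain set)"
proof -
  obtain k where k: "m = Suc k" "c \<in> steady k"
    using c by (auto simp: upper_cycles_def)
  let ?e = "(-1) ^ Suc m :: 'k"
  \<comment> \<open>Up to sign, \<open>g i\<close> is the rotated term in the boundary of the i-th
    summand. Since \<open>?e * ?e = 1\<close>, the exponent i + 1 can replace i - 1, so that no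
    negative index arises; the ends of the telescope agree after a full turn of sign 1.\<close>
  define g :: "nat \<Rightarrow> ('v, 'a, 'k) chain" where
    "g i = scale (?e ^ Suc i) (basis_chain k (rot_left Q ((rot_right Q ^^ i) c)))" for i
  have "bdry Q R m (scale ((-1) ^ (Suc m * i)) (basis_chain m ((rot_right Q ^^ i) c))) = g (Suc i) - g i" for i
  proof -
    have "rot_left Q ((rot_right Q ^^ Suc i) c) = (rot_right Q ^^ i) c"
      using rot_left_right[OF rot_right_funpow_closed] steady_closed[OF k(2)] by simp
    moreover have "(rot_right Q ^^ i) c \<in> admissible m"
      using rot_right_funpow_upper[OF c] upper_admissible by blast
    moreover have "?e * ?e = 1"
      by simp
    ultimately show ?thesis
      unfolding g_def power_mult k(1)
      by (simp add: bdry_scale bdry_basis_chain scale_add scale_minus scale_minus_left algebra_simps)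
  qed
  then have "bdry Q R m (\<Sum>i<r. scale ((-1) ^ (Suc m * i)) (basis_chain m ((rot_right Q ^^ i) c))) = g r - g 0"
    by (simp add: bdry_sum sum_lessThan_telescope)
  moreover have "?e ^ r = 1"
    using r(2) by (simp only: power_mult)
  then have "g r = g 0"
    by (simp only: g_def power_Suc[of ?e] r(1) funpow_0 power_0)
  ultimately show ?thesis
    by (simp add: hcycles_def chains_sum chains_scale basis_chain_in_chains)
qed

text \<open>The difference is the boundary of \<open>rot_right Q c\<close> taken one degree higher.
  A vertex is fixed by rotation and occurs in degree 0 only, where the difference is 0.\<close>

lemma lower_rot_right_homologous:
  assumes "c \<in> lower_cycles m"
  shows "basis_chain m (rot_right Q c) - scale ((-1) ^ m) (basis_chain m c) \<in>
    (hboundaries Q R m :: ('v, 'a, 'k::field) chain set)"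
proof (cases "snd c = []")
  case True
  then show ?thesis
    using assms by (auto simp: rot_right_def hboundaries_zero dest!: lower_admissible empty_in_admissible)
next
  case False
  then have c: "c \<in> steady m"
    using assms by (auto simp: lower_cycles_def)
  then have *: "basis_chain m (rot_right Q c) - scale ((-1) ^ m) (basis_chain m c) =
      bdry Q R (Suc m) (basis_chain (Suc m) (rot_right Q c) :: ('v, 'a, 'k) chain)"
    using rot_right_steady[OF c] rot_left_right[OF steady_closed[OF c]]
    by (auto simp: bdry_basis_chain steady_def scale_minus_left)
  show ?thesis
    unfolding * by (intro hboundariesI basis_chain_in_chains)
qed

lemma lower_rot_right_funpow_homologous:
  assumes "c \<in> lower_cycles m"
  shows "basis_chain m ((rot_right Q ^^ i) c) - scale ((-1) ^ (m * i)) (basis_chain m c) \<in>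
    (hboundaries Q R m :: ('v, 'a, 'k::field) chain set)"
proof (induction i)
  case (Suc i)
  let ?d = "(rot_right Q ^^ i) c"
  have "basis_chain m (rot_right Q ?d) - scale ((-1) ^ m) (basis_chain m ?d) +
      scale ((-1) ^ m) (basis_chain m ?d - scale ((-1) ^ (m * i)) (basis_chain m c)) \<in>
      (hboundaries Q R m :: ('v, 'a, 'k) chain set)"
    by (intro hboundaries_add hboundaries_scale Suc lower_rot_right_homologous
        rot_right_funpow_lower assms)
  then show ?case
    by (simp add: scale_minus power_add)
qed (simp add: hboundaries_zero)

section \<open>Coefficients of boundaries and cycles along a circuit\<close>

lemma hboundaries_coef_upper:
  assumes "b \<in> hboundaries Q R m" "c \<in> upper_cycles m"
  shows "coef m b c = 0"
proof -
  obtain x where "x \<in> chains Q R (Suc m)" "b = bdry Q R (Suc m) x"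
    using assms(1) by (auto simp: hboundaries_def)
  then show ?thesis
    using coef_bdry[of x m c] upper_admissible[OF assms(2)] coef_eq_zero[of x "Suc m"]
      upper_not_admissible_Suc[OF assms(2)] upper_not_admissible_Suc[OF rot_right_upper[OF assms(2)]]
    by simp
qed

text \<open>The functional dual to the cokernel of the two-term complex: by \<open>coef_bdry\<close>
  the sum telescopes, and the assumptions on r make its two ends equal.\<close>

lemma hboundaries_coef_lower:
  fixes b :: "('v, 'a, 'k::field) chain"
  assumes "b \<in> hboundaries Q R m" "c \<in> lower_cycles m"
    and r: "(rot_right Q ^^ r) c = c" "(-1) ^ (m * r) = (1::'k)"
  shows "(\<Sum>i<r. (-1) ^ (m * i) * coef m b ((rot_right Q ^^ i) c)) = 0"
proof -
  obtain x where x: "x \<in> chains Q R (Suc m)" "b = bdry Q R (Suc m) x"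
    using assms(1) by (auto simp: hboundaries_def)
  define g where "g i = (-1) ^ (m * i) * coef (Suc m) x ((rot_right Q ^^ i) c)" for i
  have "(-1) ^ (m * i) * coef m b ((rot_right Q ^^ i) c) = g i - g (Suc i)" for i
    unfolding x(2) coef_bdry[OF x(1) lower_admissible[OF rot_right_funpow_lower[OF assms(2)]]]
    by (simp add: g_def power_add algebra_simps)
  then have "(\<Sum>i<r. (-1) ^ (m * i) * coef m b ((rot_right Q ^^ i) c)) = g 0 - g r"
    by (simp add: sum_lessThan_telescope')
  then show ?thesis
    using r by (simp add: g_def)
qed

text \<open>The boundary vanishes at every rotation of c in degree m - 1, which is a first-order
  recursion along the circuit. Thus one coefficient of a cycle determines all those on the
  circuit.\<close>

lemma hcycles_coef_upper:
  assumes y: "y \<in> hcycles Q R m" and c: "c \<in> upper_cycles m"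
  shows "coef m y ((rot_right Q ^^ i) c) = (-1) ^ (Suc m * i) * coef m y c"
proof (induction i)
  case (Suc i)
  let ?d = "(rot_right Q ^^ i) c"
  obtain k where k: "m = Suc k" "?d \<in> steady k"
    using rot_right_funpow_upper[OF c, of i] by (auto simp: upper_cycles_def)
  have "coef m y ?d + (-1) ^ m * coef m y (rot_right Q ?d) = 0"
    using coef_bdry[of y k ?d] y k by (simp add: hcycles_def steady_def)
  then have "coef m y (rot_right Q ?d) = (-1) ^ Suc m * coef m y ?d"
    by (cases "even m") (simp_all add: eq_neg_iff_add_eq_0 add.commute)
  then show ?case
    by (simp add: Suc power_add)
qed simp


section \<open>Homology of the two-term complexes\<close>

definition rot_period :: "('v, 'a) qpath \<Rightarrow> nat" where
  "rot_period c = (LEAST n. n \<ge> 1 \<and> (rot_right Q ^^ n) c = c)"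

lemma rot_period:
  assumes "c \<in> closed_paths Q"
  shows rot_period_pos: "rot_period c \<ge> 1" and funpow_rot_period: "(rot_right Q ^^ rot_period c) c = c"
proof -
  obtain n where "n \<ge> 1 \<and> (rot_right Q ^^ n) c = c"
    using rot_right_pos_period[OF assms] by (metis One_nat_def Suc_leI)
  then have "rot_period c \<ge> 1 \<and> (rot_right Q ^^ rot_period c) c = c"
    unfolding rot_period_def by (rule LeastI)
  then show "rot_period c \<ge> 1" "(rot_right Q ^^ rot_period c) c = c"
    by blast+
qed

lemma funpow_less_rot_period: "\<lbrakk>(rot_right Q ^^ n) c = c; n < rot_period c\<rbrakk> \<Longrightarrow> n = 0"
  unfolding rot_period_def using not_less_Least by fastforce

lemma funpow_sym:
  assumes "c \<in> closed_paths Q" "d = (rot_right Q ^^ i) c"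
  obtains j where "c = (rot_right Q ^^ j) d"
proof -
  have "(rot_right Q ^^ (k * rot_period c)) c = c" for k
    by (induction k) (auto simp: funpow_add funpow_rot_period assms(1))
  \<comment> \<open>The multiple \<open>i * rot_period c\<close> of the period is at least i, so the
    subtraction is not truncated.\<close>
  then have "c = (rot_right Q ^^ (i * rot_period c - i + i)) c"
    using rot_period_pos[OF assms(1)] by simp
  then have "c = (rot_right Q ^^ (i * rot_period c - i)) d"
    by (simp add: funpow_add assms(2))
  then show thesis
    by (rule that)
qed

lemma keys_diff_scale_subset:
  assumes "\<And>p. p \<in> Poly_Mapping.keys z \<Longrightarrow> p \<in> Poly_Mapping.keys y" "q \<in> Poly_Mapping.keys y"
    "Poly_Mapping.lookup y q = a * Poly_Mapping.lookup z q"
  shows "Poly_Mapping.keys (y - scale a z) \<subset> Poly_Mapping.keys y"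
  using assms by (force simp: in_keys_iff lookup_minus)

text \<open>The class of \<open>z j\<close> is detected by the coefficient at \<open>w j\<close> if \<open>j \<in> A\<close>, and by an alternating
  sum of coefficients over the circuit of \<open>w j\<close>, which vanishes on boundaries, if \<open>j \<in> B\<close>.\<close>

lemma freely_spanned_by_classesI:
  fixes z :: "'j \<Rightarrow> ('v, 'a, 'k::field) chain" and w :: "'j \<Rightarrow> ('v, 'a) qpath"
  assumes J: "J = A \<union> B"
    and A: "\<And>j. j \<in> A \<Longrightarrow> w j \<in> upper_cycles m"
    and A_sign: "\<And>j. j \<in> A \<Longrightarrow> (-1) ^ (Suc m * rot_period (w j)) = (1::'k)"
    and A_z: "\<And>j. j \<in> A \<Longrightarrow>
      z j = (\<Sum>i<rot_period (w j). scale ((-1) ^ (Suc m * i)) (basis_chain m ((rot_right Q ^^ i) (w j))))"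
    and A_ex: "\<And>c. \<lbrakk>c \<in> upper_cycles m; (-1) ^ (Suc m * rot_period c) = (1::'k)\<rbrakk> \<Longrightarrow>
      \<exists>j\<in>A. \<exists>i. w j = (rot_right Q ^^ i) c"
    and A_inj: "\<And>j j' i. \<lbrakk>j \<in> A; j' \<in> A; w j' = (rot_right Q ^^ i) (w j)\<rbrakk> \<Longrightarrow> j' = j"
    and B: "\<And>j. j \<in> B \<Longrightarrow> w j \<in> lower_cycles m"
    and B_sign: "\<And>j. j \<in> B \<Longrightarrow> (-1) ^ (m * rot_period (w j)) = (1::'k)"
    and B_z: "\<And>j. j \<in> B \<Longrightarrow> z j = basis_chain m (w j)"
    and B_ex: "\<And>c. \<lbrakk>c \<in> lower_cycles m; (-1) ^ (m * rot_period c) = (1::'k)\<rbrakk> \<Longrightarrow>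
      \<exists>j\<in>B. \<exists>i. w j = (rot_right Q ^^ i) c"
    and B_inj: "\<And>j j' i. \<lbrakk>j \<in> B; j' \<in> B; w j' = (rot_right Q ^^ i) (w j)\<rbrakk> \<Longrightarrow> j' = j"
  shows "freely_spanned_by_classes Q R m J z"
proof -
  note closed = admissible_closed[OF upper_admissible] admissible_closed[OF lower_admissible]
  define S where "S = {x. \<exists>c. Poly_Mapping.keys c \<subseteq> J \<and> x - lin_ext z c \<in> hboundaries Q R m}"
  have S_bdry: "x \<in> S" if "x \<in> hboundaries Q R m" for x
    unfolding S_def using that by (auto intro!: exI[of _ 0])
  have S_add: "x + y \<in> S" if xy: "x \<in> S" "y \<in> S" for x y
  proof -
    obtain c d where c: "Poly_Mapping.keys c \<subseteq> J" "x - lin_ext z c \<in> hboundaries Q R m"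
      and d: "Poly_Mapping.keys d \<subseteq> J" "y - lin_ext z d \<in> hboundaries Q R m"
      using xy by (auto simp: S_def)
    have "x + y - lin_ext z (c + d) \<in> hboundaries Q R m"
      using hboundaries_add[OF c(2) d(2)] by (simp add: lin_ext_add algebra_simps)
    moreover have "Poly_Mapping.keys (c + d) \<subseteq> J"
      using keys_add[of c d] c(1) d(1) by blast
    ultimately show ?thesis
      by (auto simp: S_def)
  qed
  have S_scale: "scale a x \<in> S" if x: "x \<in> S" for a x
  proof -
    obtain c where c: "Poly_Mapping.keys c \<subseteq> J" "x - lin_ext z c \<in> hboundaries Q R m"
      using x by (auto simp: S_def)
    have "scale a x - lin_ext z (scale a c) \<in> hboundaries Q R m"
      using hboundaries_scale[OF c(2), of a] by (simp add: lin_ext_scale scale_minus)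
    moreover have "Poly_Mapping.keys (scale a c) \<subseteq> J"
      using keys_scale_subset[of a c] c(1) by blast
    ultimately show ?thesis
      by (auto simp: S_def)
  qed
  have S_z: "z j \<in> S" if "j \<in> J" for j
    unfolding S_def using that
    by (auto intro!: exI[of _ "Poly_Mapping.single j 1"] simp: hboundaries_zero)

  have z_coef: "coef m (z j) c =
      (\<Sum>i<rot_period (w j). (-1) ^ (Suc m * i) * (if c = (rot_right Q ^^ i) (w j) then 1 else 0))"
    if "j \<in> A" for j c
    using upper_admissible[OF rot_right_funpow_upper[OF A[OF that]]]
    by (simp add: A_z[OF that] coef_sum coef_basis_chain)
  have z_coef_self: "coef m (z j) (w j) = 1" if "j \<in> A" for j
  proof -
    have "coef m (z j) (w j) = (\<Sum>i<rot_period (w j). if i = 0 then 1 else 0)"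
      unfolding z_coef[OF that] using funpow_less_rot_period[of _ "w j"] by (intro sum.cong) auto
    then show ?thesis
      using rot_period_pos[OF closed(1)[OF A[OF that]]] by simp
  qed
  have z_coef_zero: "coef m (z j) c = 0" if "j \<in> A" "\<And>i. c \<noteq> (rot_right Q ^^ i) (w j)" for j c
    unfolding z_coef[OF that(1)] using that(2) by simp

  have z_cycle: "z j \<in> hcycles Q R m" if "j \<in> J" for j
  proof (cases "j \<in> A")
    case True
    then show ?thesis
      unfolding A_z[OF True] by (intro upper_sum_cycle A funpow_rot_period closed(1)[of _ m] A_sign True)
  next
    case False
    then show ?thesis
      using that J B[of j] B_z[of j] lower_basis_chain_cycle[of "w j" m] by auto
  qed

  have S_lower: "basis_chain m u \<in> S" if u: "u \<in> lower_cycles m" for u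
  proof (cases "(-1) ^ (m * rot_period u) = (1::'k)")
    case True
    then obtain j i where j: "j \<in> B" "w j = (rot_right Q ^^ i) u"
      using B_ex[OF u] by blast
    let ?d = "(-1) ^ (m * i) :: 'k"
    have "basis_chain m (w j) - scale ?d (basis_chain m u) \<in> S"
      unfolding j(2) by (intro S_bdry lower_rot_right_funpow_homologous u)
    moreover have "basis_chain m (w j) \<in> S"
      using S_z[of j] j(1) B_z J by simp
    \<comment> \<open>The terms in \<open>w j\<close> cancel and \<open>?d * ?d = 1\<close>, so this
      combination is the basis element of u.\<close>
    ultimately have "scale ?d (basis_chain m (w j)) + scale (- ?d) (basis_chain m (w j) - scale ?d (basis_chain m u)) \<in> S"
      by (intro S_add S_scale)
    moreover have "?d * ?d = 1"
      by (simp flip: power_add)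
    ultimately show ?thesis
      by (simp add: scale_minus scale_minus_left)
  next
    case False
    \<comment> \<open>Going once round the circuit makes \<open>1 - ?d\<close> times the basis
      element of u a boundary. The factor is invertible, so the class of u is 0.\<close>
    let ?d = "(-1) ^ (m * rot_period u) :: 'k"
    have "basis_chain m u - scale ?d (basis_chain m u) \<in> (hboundaries Q R m :: ('v, 'a, 'k) chain set)"
      using lower_rot_right_funpow_homologous[OF u, of "rot_period u", where 'k = 'k]
        funpow_rot_period[OF closed(2)[OF u]] by simp
    then have "scale (1 / (1 - ?d)) (basis_chain m u - scale ?d (basis_chain m u)) \<in> S"
      by (intro S_bdry hboundaries_scale)
    moreover have "basis_chain m u - scale ?d (basis_chain m u) = scale (1 - ?d) (basis_chain m u)"
      using scale_add_left[of 1 "- ?d" "basis_chain m u"] by (simp add: scale_minus_left)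
    ultimately show ?thesis
      using False by simp
  qed
  have S_steady: "y \<in> S"
    if "y \<in> hcycles Q R m" "Poly_Mapping.keys y \<subseteq> split_path Q m ` (upper_cycles m \<union> lower_cycles m)" for y
    using that
  \<comment> \<open>Elimination: subtracting a multiple of a cycle supported inside the support of y
    removes one key and adds none, so the support stays among upper and lower cycles.\<close>
  proof (induction "card (Poly_Mapping.keys y)" arbitrary: y rule: less_induct)
    case less
    have step: "y \<in> S"
      if "x \<in> S" "x \<in> hcycles Q R m" "Poly_Mapping.keys (y - scale a x) \<subset> Poly_Mapping.keys y" for a x
    proof -
      have "y - scale a x \<in> S"
        using that less.prems
        by (intro less.hyps psubset_card_mono hcycles_minus hcycles_scale) auto
      then have "y - scale a x + scale a x \<in> S"
        by (intro S_add S_scale that)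
      then show ?thesis
        by simp
    qed
    show ?case
    proof (cases "y = 0")
      case True
      then show ?thesis
        by (simp add: S_bdry hboundaries_zero)
    next
      case False
      then obtain p where p: "p \<in> Poly_Mapping.keys y"
        by (metis ex_in_conv keys_eq_empty)
      then obtain c where c: "p = split_path Q m c" "c \<in> upper_cycles m \<union> lower_cycles m"
        using less.prems(2) by auto
      from c(2) show ?thesis
      proof
        assume "c \<in> lower_cycles m"
        moreover from this have "Poly_Mapping.keys (y - scale (coef m y c) (basis_chain m c)) \<subset> Poly_Mapping.keys y"
          using p c(1) lower_admissible
          by (intro keys_diff_scale_subset[of _ _ p]) (auto simp: basis_chain_def coef_def)
        ultimately show ?thesis
          using step S_lower lower_basis_chain_cycle by blast
      next
        assume upper_cycles: "c \<in> upper_cycles m"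
        have y_rot: "coef m y ((rot_right Q ^^ i) c) = (-1) ^ (Suc m * i) * coef m y c" for i
          by (rule hcycles_coef_upper[OF less.prems(1) upper_cycles])
        have "coef m y c \<noteq> 0"
          using p c(1) by (simp add: coef_def in_keys_iff)
        \<comment> \<open>A full turn returns to the same nonzero coefficient multiplied by the
          sign, so circuits of the wrong sign cannot occur in a cycle.\<close>
        then have "(-1) ^ (Suc m * rot_period c) = (1::'k)"
          using y_rot[of "rot_period c"] funpow_rot_period[OF closed(1)[OF upper_cycles]] by simp
        then obtain j i where j: "j \<in> A" "w j = (rot_right Q ^^ i) c"
          using A_ex[OF upper_cycles] by blast
        have "Poly_Mapping.keys (y - scale (coef m y (w j)) (z j)) \<subset> Poly_Mapping.keys y"
        proof (rule keys_diff_scale_subset[of _ _ "split_path Q m (w j)"])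
          have y_nz: "coef m y (w j) \<noteq> 0"
            using y_rot[of i] \<open>coef m y c \<noteq> 0\<close> j(2) by simp
          then show "split_path Q m (w j) \<in> Poly_Mapping.keys y"
            by (simp add: coef_def in_keys_iff)
          show "Poly_Mapping.lookup y (split_path Q m (w j)) =
              coef m y (w j) * Poly_Mapping.lookup (z j) (split_path Q m (w j))"
            using z_coef_self[OF j(1)] by (simp add: coef_def)
          fix q assume q: "q \<in> Poly_Mapping.keys (z j)"
          then obtain d where d: "q = split_path Q m d"
            using z_cycle[of j] j(1) J by (auto simp: hcycles_def elim!: chains_cases)
          then have "coef m (z j) d \<noteq> 0"
            using q by (simp add: coef_def in_keys_iff)
          then obtain l where "d = (rot_right Q ^^ l) (w j)"
            using z_coef_zero[OF j(1)] by blast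
          \<comment> \<open>A cycle that is nonzero at one path of an upper circuit is nonzero on
            the whole circuit, so the support of \<open>z j\<close> lies in that of y.\<close>
          then have "coef m y d \<noteq> 0"
            using hcycles_coef_upper[OF less.prems(1) A[OF j(1)]] y_nz by simp
          then show "q \<in> Poly_Mapping.keys y"
            by (simp add: d coef_def in_keys_iff)
        qed
        then show ?thesis
          using step S_z z_cycle j(1) J by blast
      qed
    qed
  qed
  have spanning: "x \<in> S" if x: "x \<in> hcycles Q R m" for x
  proof -
    obtain y where "y \<in> hcycles Q R m" "x - y \<in> hboundaries Q R m"
      "Poly_Mapping.keys y \<subseteq> split_path Q m ` (upper_cycles m \<union> lower_cycles m)"
      using homologous_to_steady[OF x] by blast
    then have "x - y + y \<in> S"
      by (intro S_add S_bdry S_steady)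
    then show ?thesis
      by simp
  qed

  have independent: "c = 0" if c: "Poly_Mapping.keys c \<subseteq> J" "lin_ext z c \<in> hboundaries Q R m" for c
  proof (rule ccontr)
    assume "c \<noteq> 0"
    then obtain j where j: "j \<in> Poly_Mapping.keys c"
      by (metis ex_in_conv keys_eq_empty)
    \<comment> \<open>A functional dual to \<open>z j\<close> extracts the coefficient of j in c,
      which is nonzero. The signs s and the paths d remain free so that this serves both kinds of
      index.\<close>
    have nonzero: "(\<Sum>i<r. s i * coef m (lin_ext z c) (d i)) \<noteq> 0"
      if "(\<Sum>i<r. s i * coef m (z j) (d i)) = 1"
        "\<And>j'. j' \<in> J \<Longrightarrow> j' \<noteq> j \<Longrightarrow> (\<Sum>i<r. s i * coef m (z j') (d i)) = 0" for r :: nat and s d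
    proof -
      have "(\<Sum>i<r. s i * coef m (lin_ext z c) (d i)) =
          (\<Sum>j'\<in>Poly_Mapping.keys c. Poly_Mapping.lookup c j' * (\<Sum>i<r. s i * coef m (z j') (d i)))"
        by (simp add: coef_def lookup_lin_ext sum_distrib_left mult.left_commute
            sum.swap[of _ "{..<r}"])
      also have "\<dots> = (\<Sum>j'\<in>Poly_Mapping.keys c. if j' = j then Poly_Mapping.lookup c j' else 0)"
        using that c(1) by (intro sum.cong) auto
      finally show ?thesis
        using j by (simp add: in_keys_iff)
    qed
    show False
    proof (cases "j \<in> A")
      case True
      have "coef m (z j') (w j) = 0" if "j' \<in> J" "j' \<noteq> j" for j'
      proof (cases "j' \<in> A")
        case j': True
        then show ?thesis
          using z_coef_zero[of j' "w j"] A_inj[of j' j] True that by blast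
      next
        case False
        then have "j' \<in> B"
          using that J by blast
        then show ?thesis
          using B[of j'] B_z[of j'] A[OF True] upper_lower_disjoint[of "w j" m] by (auto simp: coef_basis_chain)
      qed
      \<comment> \<open>For an upper cycle the functional is one coefficient, written as a sum with
        one term to match \<open>nonzero\<close>.\<close>
      then have "(\<Sum>i<1::nat. 1 * coef m (lin_ext z c) (w j)) \<noteq> 0"
        using z_coef_self[OF True] by (intro nonzero) auto
      then have "coef m (lin_ext z c) (w j) \<noteq> 0"
        by simp
      then show False
        using hboundaries_coef_upper[OF c(2) A[OF True]] by contradiction
    next
      case False
      then have jB: "j \<in> B"
        using j c(1) J by blast
      let ?F = "\<lambda>x. \<Sum>i<rot_period (w j). (-1) ^ (m * i) * coef m x ((rot_right Q ^^ i) (w j))"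
      have lower_cycles: "(rot_right Q ^^ i) (w j) \<in> lower_cycles m" for i
        by (rule rot_right_funpow_lower[OF B[OF jB]])
      have "?F (z j) = (\<Sum>i<rot_period (w j). if i = 0 then 1 else 0)"
        using funpow_less_rot_period[of _ "w j"] lower_admissible[OF B[OF jB]]
        by (intro sum.cong) (auto simp: B_z[OF jB] coef_basis_chain)
      then have "?F (z j) = 1"
        using rot_period_pos[OF closed(2)[OF B[OF jB]]] by simp
      moreover have "?F (z j') = 0" if "j' \<in> J" "j' \<noteq> j" for j'
      proof -
        have "coef m (z j') ((rot_right Q ^^ i) (w j)) = 0" for i
        proof (cases "j' \<in> A")
          case True
          then show ?thesis
            using z_coef_zero[OF True] rot_right_funpow_upper[OF A[OF True]] upper_lower_disjoint lower_cycles
            by metis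
        next
          case False
          then have "j' \<in> B"
            using that J by blast
          then show ?thesis
            using B_inj[OF jB, of j' i] that B_z by (auto simp: coef_basis_chain)
        qed
        then show ?thesis
          by simp
      qed
      ultimately have "?F (lin_ext z c) \<noteq> 0"
        by (rule nonzero)
      then show False
        using hboundaries_coef_lower[OF c(2) B[OF jB] funpow_rot_period B_sign[OF jB]] closed(2)[OF B[OF jB]]
        by simp
    qed
  qed

  show ?thesis
    unfolding freely_spanned_by_classes_def lin_ext_def[symmetric]
  proof (intro conjI ballI)
    fix h :: "('v, 'a, 'k) chain set" assume "h \<in> HH Q R m"
    then obtain x where x: "x \<in> hcycles Q R m" "h = hclass Q R m x"
      by (auto simp: HH_def)
    then obtain c where c: "Poly_Mapping.keys c \<subseteq> J" "x - lin_ext z c \<in> hboundaries Q R m"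
      using spanning by (auto simp: S_def)
    show "\<exists>!c. Poly_Mapping.keys c \<subseteq> J \<and> h = hclass Q R m (lin_ext z c)"
    proof (rule ex1I[of _ c])
      show "Poly_Mapping.keys c \<subseteq> J \<and> h = hclass Q R m (lin_ext z c)"
        using c x by (simp add: hclass_eq_iff)
      fix d assume d: "Poly_Mapping.keys d \<subseteq> J \<and> h = hclass Q R m (lin_ext z d)"
      then have "x - lin_ext z d \<in> hboundaries Q R m"
        using x by (simp add: hclass_eq_iff)
      then have "(x - lin_ext z c) - (x - lin_ext z d) \<in> hboundaries Q R m"
        by (rule hboundaries_minus[OF c(2)])
      then have "lin_ext z (d - c) \<in> hboundaries Q R m"
        by (simp add: lin_ext_minus)
      moreover have "Poly_Mapping.keys (d - c) \<subseteq> J"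
        using keys_diff[of d c] c(1) d by blast
      ultimately show "d = c"
        using independent[of "d - c"] by simp
    qed
  qed (rule z_cycle)
qed


section \<open>Circuits\<close>

lemma rot_funpow_eq: "c \<in> qcycles Q \<Longrightarrow> (rot Q ^^ i) c = (rot_right Q ^^ i) c"
proof (induction i)
  case (Suc i)
  have "snd ((rot_right Q ^^ i) c) \<noteq> []"
    using Suc.prems by (induction i) (auto simp: in_qcycles_iff rot_right_def rot_eq)
  then show ?case
    using Suc by (simp add: rot_right_def[of Q "(rot_right Q ^^ i) c"])
qed simp

lemma qcycles_closed: "c \<in> qcycles Q \<Longrightarrow> c \<in> closed_paths Q"
  by (simp add: in_qcycles_iff)

lemma rot_right_qcycle: "c \<in> qcycles Q \<Longrightarrow> rot_right Q c \<in> qcycles Q"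
  by (auto simp: in_qcycles_iff rot_right_closed) (auto simp: rot_right_def rot_eq)

lemma rot_right_funpow_qcycle: "c \<in> qcycles Q \<Longrightarrow> (rot_right Q ^^ i) c \<in> qcycles Q"
  by (induction i) (auto simp: rot_right_qcycle)

definition orbit :: "('v, 'a) qpath \<Rightarrow> ('v, 'a) qpath set" where
  "orbit c = {(rot_right Q ^^ i) c | i. True}"

lemma circuits_eq: "circuits Q = orbit ` qcycles Q"
proof -
  have "{(c, c'). c \<in> qcycles Q \<and> (\<exists>i. c' = (rot Q ^^ i) c)} `` {x} = orbit x" if "x \<in> qcycles Q" for x
    using that by (auto simp: orbit_def rot_funpow_eq)
  then show ?thesis
    by (auto simp: circuits_def quotient_def)
qed

lemma orbit_self: "c \<in> orbit c"
  unfolding orbit_def by (auto intro: exI[of _ 0])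

text \<open>Rotation has finite order on a closed path, so orbits under nonnegative powers are
  already equivalence classes.\<close>

lemma orbit_eq:
  assumes "c \<in> closed_paths Q" "d \<in> orbit c"
  shows "orbit d = orbit c"
proof -
  obtain i where i: "d = (rot_right Q ^^ i) c"
    using assms(2) by (auto simp: orbit_def)
  then obtain j where j: "c = (rot_right Q ^^ j) d"
    using funpow_sym[OF assms(1)] by blast
  show ?thesis
  proof (intro equalityI subsetI)
    fix x assume "x \<in> orbit d"
    then obtain k where "x = (rot_right Q ^^ k) d"
      by (auto simp: orbit_def)
    then have "x = (rot_right Q ^^ (k + i)) c"
      by (simp add: funpow_add i)
    then show "x \<in> orbit c"
      by (auto simp: orbit_def)
  next
    fix x assume "x \<in> orbit c"
    then obtain k where "x = (rot_right Q ^^ k) c"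
      by (auto simp: orbit_def)
    then have "x = (rot_right Q ^^ (k + j)) d"
      using j by (simp add: funpow_add)
    then show "x \<in> orbit d"
      by (auto simp: orbit_def)
  qed
qed

lemma circuit_cases:
  assumes "C \<in> circuits Q" "c \<in> C"
  shows circuit_qcycle: "c \<in> qcycles Q" and circuit_eq_orbit: "C = orbit c"
proof -
  obtain x where "x \<in> qcycles Q" "C = orbit x"
    using assms(1) by (auto simp: circuits_eq)
  then show "c \<in> qcycles Q" "C = orbit c"
    using assms(2) orbit_eq[of x c] by (auto simp: orbit_def rot_right_funpow_qcycle qcycles_closed)
qed

text \<open>Powers of the rotation commute, so a power fixing one cycle of a circuit fixes all of
  them.\<close>

lemma period_eq_rot_period:
  assumes "C \<in> circuits Q" "c \<in> C"
  shows "period Q C = rot_period c"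
proof -
  have "(\<forall>d\<in>C. (rot Q ^^ i) d = d) \<longleftrightarrow> (rot_right Q ^^ i) c = c" for i
  proof
    assume "\<forall>d\<in>C. (rot Q ^^ i) d = d"
    then show "(rot_right Q ^^ i) c = c"
      using assms rot_funpow_eq[OF circuit_qcycle[OF assms]] by metis
  next
    assume *: "(rot_right Q ^^ i) c = c"
    show "\<forall>d\<in>C. (rot Q ^^ i) d = d"
    proof
      fix d assume d: "d \<in> C"
      then obtain j where "d = (rot_right Q ^^ j) c"
        using circuit_eq_orbit[OF assms] by (auto simp: orbit_def)
      moreover have "(rot_right Q ^^ i) ((rot_right Q ^^ j) c) = (rot_right Q ^^ j) ((rot_right Q ^^ i) c)"
        by (metis add.commute comp_apply funpow_add)
      ultimately have "(rot_right Q ^^ i) d = d"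
        using * by simp
      then show "(rot Q ^^ i) d = d"
        using rot_funpow_eq[OF circuit_qcycle[OF assms(1) d]] by simp
    qed
  qed
  then show ?thesis
    by (simp add: period_def rot_period_def)
qed

lemma length_rot_right [simp]: "length (snd (rot_right Q c)) = length (snd c)"
  by (cases "snd c") (simp_all add: rot_right_def rot_eq)

lemma length_rot_right_funpow [simp]: "length (snd ((rot_right Q ^^ i) c)) = length (snd c)"
  by (induction i) auto

lemma circuits_of_length_iff:
  assumes "c \<in> C"
  shows "C \<in> circuits_of_length Q m \<longleftrightarrow> C \<in> circuits Q \<and> length (snd c) = m"
proof -
  have "length (snd d) = length (snd c)" if "C \<in> circuits Q" "d \<in> C" for d
    using that circuit_eq_orbit[OF that(1) assms] by (auto simp: orbit_def)
  then show ?thesis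
    using assms by (auto simp: circuits_of_length_def plength_def)
qed

lemma square_rot_right_funpow:
  assumes "c \<in> qcycles Q" "successively P (snd c @ snd c)"
  shows "successively P (snd ((rot_right Q ^^ i) c) @ snd ((rot_right Q ^^ i) c))"
proof (induction i)
  case (Suc i)
  have "snd ((rot_right Q ^^ i) c) \<noteq> []"
    using rot_right_funpow_qcycle[OF assms(1)] by (simp add: in_qcycles_iff)
  then show ?case
    using successively_square_rotate_right[OF Suc] by (simp add: rot_right_def rot_eq)
qed (use assms in simp)

lemma square_in_qpaths: "c \<in> closed_paths Q \<Longrightarrow> c \<cdot> c \<in> qpaths Q"
  by (auto simp: closed_paths_def pcomp_in_qpaths_iff)

text \<open>The condition on the square is invariant under rotation, so it can be tested on any
  cycle of the circuit, in particular on the chosen one.\<close>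

lemma complete_circuit_iff:
  assumes "c \<in> C"
  shows "complete_circuit Q R C \<longleftrightarrow> C \<in> circuits Q \<and> successively rel (snd c @ snd c)"
proof -
  have "successively rel (snd c @ snd c)"
    if "C \<in> circuits Q" "d \<in> C" "successively rel (snd d @ snd d)" for d
    using square_rot_right_funpow[OF circuit_qcycle[OF that(1,2)] that(3)]
      circuit_eq_orbit[OF that(1,2)] assms by (auto simp: orbit_def)
  then show ?thesis
    using assms square_in_qpaths[OF qcycles_closed[OF circuit_qcycle]]
    by (auto simp: complete_circuit_def in_Gamma_iff pcomp_def)
qed

lemma cocomplete_circuit_iff:
  assumes "c \<in> C"
  shows "cocomplete_circuit Q R C \<longleftrightarrow>
    C \<in> circuits Q \<and> successively (\<lambda>a b. \<not> rel a b) (snd c @ snd c)"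
proof -
  have "successively (\<lambda>a b. \<not> rel a b) (snd c @ snd c)"
    if "C \<in> circuits Q" "d \<in> C" "successively (\<lambda>a b. \<not> rel a b) (snd d @ snd d)" for d
    using square_rot_right_funpow[OF circuit_qcycle[OF that(1,2)] that(3)]
      circuit_eq_orbit[OF that(1,2)] assms by (auto simp: orbit_def)
  then show ?thesis
    using assms square_in_qpaths[OF qcycles_closed[OF circuit_qcycle]]
    by (auto simp: cocomplete_circuit_def in_B_iff pcomp_def)
qed

section \<open>The generators as basis elements of closed paths\<close>

lemma pair_eq_basis_chain:
  assumes "c \<in> admissible m" "\<alpha> \<cdot> \<gamma> = c" "plength \<gamma> = m" "src \<alpha> = tgt Q \<gamma>"
  shows "pair \<alpha> \<gamma> = basis_chain m c"
proof -
  have "split_path Q m (\<alpha> \<cdot> \<gamma>) = (\<alpha>, \<gamma>)"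
    using assms(3,4) by (cases \<alpha>) (auto simp: split_path_def pcomp_def plength_def src_def)
  then show ?thesis
    using assms(1,2) by (simp add: pair_def basis_chain_def)
qed

lemma pair_vertex_left:
  assumes "c \<in> admissible m" "length (snd c) = m"
  shows "pair (vpath (src c)) c = basis_chain m c"
proof (rule pair_eq_basis_chain)
  have "src c = tgt Q c"
    using admissible_closed[OF assms(1)] by (simp add: closed_paths_def)
  then show "src (vpath (src c)) = tgt Q c"
    by (simp add: vpath_def src_def)
qed (use assms in \<open>simp_all add: plength_def pcomp_def vpath_def\<close>)

lemma pair_vertex_right: "c \<in> admissible 0 \<Longrightarrow> pair c (vpath (src c)) = basis_chain 0 c"
  by (intro pair_eq_basis_chain) (simp_all add: vpath_def pcomp_def src_def plength_def tgt_eq)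

lemma pair_first_arrow:
  assumes "c \<in> admissible 1"
  shows "pair (but_first Q c) (first_arrow Q c) = basis_chain 1 c"
proof -
  have "snd c \<noteq> []" "tail Q (hd (snd c)) = fst c"
    using assms by (auto simp: admissible_def in_closed_paths_iff)
  then show ?thesis
    using assms by (intro pair_eq_basis_chain)
      (simp_all add: but_first_def first_arrow_def arrow_def pcomp_def src_def plength_def tgt_eq prod_eq_iff)
qed

lemma pair_last_arrow:
  assumes "c \<in> admissible m" "length (snd c) = Suc m"
  shows "pair (last_arrow Q c) (but_last c) = basis_chain m c"
proof -
  obtain xs a where xs: "snd c = xs @ [a]"
    using assms(2) by (cases "snd c" rule: rev_cases) auto
  have "c \<in> qpaths Q"
    using admissible_closed[OF assms(1)] by (simp add: closed_paths_def)
  then have "tail Q a = (if xs = [] then fst c else head Q (last xs))"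
    using xs by (auto simp: in_qpaths_iff successively_append_iff)
  then show ?thesis
    using assms xs by (intro pair_eq_basis_chain)
      (simp_all add: last_arrow_def but_last_def arrow_def pcomp_def src_def plength_def tgt_eq prod_eq_iff)
qed

lemma pair_vertex: "e \<in> verts Q \<Longrightarrow> pair (vpath e) (vpath e) = basis_chain 0 (vpath e)"
  using vpath_in_qpaths[of e]
  by (intro pair_eq_basis_chain) (simp_all add: admissible_def in_closed_paths_iff pcomp_def plength_def
      vpath_def src_def tgt_eq)

text \<open>These are the complete circuits of length 1. Such a circuit has a single cycle, so the
  loop itself can be the index and no choice is involved.\<close>

definition zero_loops :: "'a set" where
  "zero_loops = {a \<in> arcs Q. tail Q a = head Q a \<and> rel a a}"

lemma loops_in_ideal_eq:
  "{a \<in> arcs Q. tail Q a = head Q a \<and>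
     Poly_Mapping.single (arrow Q a \<cdot> arrow Q a) (1::'k::field) \<in> pres_ideal Q R} = zero_loops"
proof -
  have "Poly_Mapping.single (arrow Q a \<cdot> arrow Q a) (1::'k) \<in> pres_ideal Q R \<longleftrightarrow> rel a a"
    if "a \<in> arcs Q" "tail Q a = head Q a" for a
  proof -
    have "arrow Q a \<cdot> arrow Q a \<in> qpaths Q"
      using that by (simp add: arrow_def pcomp_def in_qpaths_iff)
    then show ?thesis
      by (simp add: single_in_pres_ideal_iff in_B_iff) (simp add: arrow_def pcomp_def)
  qed
  then show ?thesis
    by (auto simp: zero_loops_def)
qed

lemma zero_loops_iff: "a \<in> zero_loops \<longleftrightarrow> arrow Q a \<in> qcycles Q \<and> rel a a"
  by (auto simp: zero_loops_def in_qcycles_iff in_closed_paths_iff in_qpaths_iff arrow_def)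

lemma qcycle_length_1:
  assumes "c \<in> qcycles Q" "length (snd c) = 1"
  obtains a where "c = arrow Q a"
proof -
  obtain a where "snd c = [a]"
    using assms(2) by (auto simp: length_Suc_conv)
  then have "c = arrow Q a"
    using assms(1) by (auto simp: in_qcycles_iff in_closed_paths_iff arrow_def prod_eq_iff)
  then show thesis
    by (rule that)
qed

lemma rot_right_arrow [simp]: "rot_right Q (arrow Q a) = arrow Q a"
  by (simp add: rot_right_def rot_eq) (simp add: arrow_def)

lemma rot_right_funpow_arrow [simp]: "(rot_right Q ^^ i) (arrow Q a) = arrow Q a"
  by (induction i) auto

lemma arrow_eq_iff [simp]: "arrow Q a = arrow Q b \<longleftrightarrow> a = b"
  and arrow_neq_vpath [simp]: "arrow Q a \<noteq> vpath e" "vpath e \<noteq> arrow Q a"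
  and vpath_eq_iff [simp]: "vpath d = vpath e \<longleftrightarrow> d = e"
  by (auto simp: arrow_def vpath_def)

lemma rot_period_arrow [simp]: "rot_period (arrow Q a) = 1"
  unfolding rot_period_def by (rule Least_equality) auto

lemma arrow_steady: "a \<in> zero_loops \<Longrightarrow> arrow Q a \<in> steady 0"
  by (auto simp: zero_loops_iff steady_iff) (auto simp: arrow_def)

lemma steady_0_iff:
  "c \<in> steady 0 \<longleftrightarrow> (\<exists>a\<in>zero_loops. c = arrow Q a) \<or>
     (c \<in> qcycles Q \<and> successively (\<lambda>a b. \<not> rel a b) (snd c @ snd c))"
proof -
  have "\<exists>a\<in>zero_loops. c = arrow Q a"
    if c: "c \<in> qcycles Q" "length (snd c) = 1" "successively rel (snd c @ snd c)"
  proof -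
    obtain a where "c = arrow Q a"
      using c qcycle_length_1 by blast
    moreover from this have "a \<in> zero_loops"
      using c by (simp add: zero_loops_iff) (simp add: arrow_def)
    ultimately show ?thesis
      by blast
  qed
  then show ?thesis
    using arrow_steady by (auto simp: steady_iff)
qed

lemma steady_admissible: "c \<in> steady m \<Longrightarrow> c \<in> admissible m"
  and steady_admissible_Suc: "c \<in> steady m \<Longrightarrow> c \<in> admissible (Suc m)"
  by (auto simp: steady_def)

lemma steady_Suc_iff:
  "c \<in> steady (Suc k) \<longleftrightarrow>
    c \<in> qcycles Q \<and> successively rel (snd c @ snd c) \<and> length (snd c) = Suc (Suc k)"
  by (auto simp: steady_iff)

lemma lower_0_iff: "c \<in> lower_cycles 0 \<longleftrightarrow> c \<in> steady 0 \<or> (\<exists>e\<in>verts Q. c = vpath e)"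
  by (cases c) (auto simp: lower_cycles_def admissible_def in_closed_paths_iff in_qpaths_iff vpath_def)

lemma lower_Suc: "lower_cycles (Suc m) = steady (Suc m)"
  by (auto simp: lower_cycles_def dest: empty_in_admissible)

lemma upper_Suc: "upper_cycles (Suc m) = steady m"
  by (simp add: upper_cycles_def)

lemma upper_0: "upper_cycles 0 = {}"
  by (simp add: upper_cycles_def)

lemma rot_right_funpow_vpath [simp]: "(rot_right Q ^^ i) (vpath e) = vpath e"
  by (induction i) (auto simp: rot_right_def vpath_def)

section \<open>Bases of the homology for one chosen cycle in each circuit\<close>

context
  fixes rep :: "('v, 'a) qpath set \<Rightarrow> ('v, 'a) qpath"
  assumes rep: "\<forall>C\<in>circuits Q. rep C \<in> C"
begin

lemma rep_qcycle: "C \<in> circuits Q \<Longrightarrow> rep C \<in> qcycles Q"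
  using rep circuit_qcycle by blast

lemma rep_in_orbit_ex:
  assumes "c \<in> qcycles Q"
  shows "orbit c \<in> circuits Q" "\<exists>i. rep (orbit c) = (rot_right Q ^^ i) c"
proof -
  show "orbit c \<in> circuits Q"
    using assms by (auto simp: circuits_eq)
  then have "rep (orbit c) \<in> orbit c"
    using rep by blast
  then show "\<exists>i. rep (orbit c) = (rot_right Q ^^ i) c"
    by (auto simp: orbit_def)
qed

lemma rep_inj:
  assumes "C \<in> circuits Q" "D \<in> circuits Q" "rep D = (rot_right Q ^^ i) (rep C)"
  shows "D = C"
proof -
  have "rep D \<in> orbit (rep C)"
    using assms(3) by (auto simp: orbit_def)
  then have "orbit (rep D) = orbit (rep C)"
    using rep_qcycle[OF assms(1)] by (intro orbit_eq qcycles_closed)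
  then show ?thesis
    using circuit_eq_orbit rep assms(1,2) by metis
qed

lemma cocomplete_steady:
  assumes "cocomplete_circuit Q R C"
  shows "C \<in> circuits Q" "rep C \<in> steady 0"
proof -
  show C: "C \<in> circuits Q"
    using assms by (simp add: cocomplete_circuit_def)
  then have "rep C \<in> C"
    using rep by blast
  then show "rep C \<in> steady 0"
    using assms C cocomplete_circuit_iff[of "rep C" C] rep_qcycle by (auto simp: steady_0_iff)
qed

lemma rep_neq_vpath [simp]: "C \<in> circuits Q \<Longrightarrow> (rot_right Q ^^ i) (rep C) \<noteq> vpath e"
  using rot_right_funpow_qcycle[OF rep_qcycle, of C i] by (auto simp: in_qcycles_iff vpath_def)

lemma cocomplete_not_arrow:
  "\<lbrakk>cocomplete_circuit Q R C; a \<in> zero_loops\<rbrakk> \<Longrightarrow> (rot_right Q ^^ i) (rep C) \<noteq> arrow Q a"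
  using square_rot_right_funpow[OF rep_qcycle, of C "\<lambda>a b. \<not> rel a b" i] cocomplete_circuit_iff[of "rep C" C] rep
  by (auto simp: cocomplete_circuit_def zero_loops_iff arrow_def)

lemma complete_steady:
  assumes "C \<in> circuits_of_length Q (Suc m)" "complete_circuit Q R C"
  shows "C \<in> circuits Q" "rep C \<in> steady m" "length (snd (rep C)) = Suc m"
proof -
  show C: "C \<in> circuits Q"
    using assms(1) by (simp add: circuits_of_length_def)
  then have "rep C \<in> C"
    using rep by blast
  then show "rep C \<in> steady m" "length (snd (rep C)) = Suc m"
    using assms C complete_circuit_iff circuits_of_length_iff rep_qcycle by (auto simp: steady_iff)
qed

lemma steady_Suc_orbit:
  assumes "c \<in> steady (Suc m)"
  shows "orbit c \<in> circuits_of_length Q (Suc (Suc m))" "complete_circuit Q R (orbit c)"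
    "period Q (orbit c) = rot_period c" "\<exists>i. rep (orbit c) = (rot_right Q ^^ i) c"
  using assms rep_in_orbit_ex[of c] orbit_self[of c]
  by (auto simp: steady_Suc_iff circuits_of_length_iff complete_circuit_iff period_eq_rot_period)

lemma cocomplete_orbit:
  assumes "c \<in> qcycles Q" "successively (\<lambda>a b. \<not> rel a b) (snd c @ snd c)"
  shows "cocomplete_circuit Q R (orbit c)" "\<exists>i. rep (orbit c) = (rot_right Q ^^ i) c"
  using assms rep_in_orbit_ex[of c] orbit_self[of c] by (auto simp: cocomplete_circuit_iff)

lemma period_rep: "C \<in> circuits Q \<Longrightarrow> period Q C = rot_period (rep C)"
  using rep period_eq_rot_period by blast

text \<open>Degree 0 has no upper cycles, and the sign \<open>(-1)^(0 * r)\<close> is always 1, so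
  every vertex and every circuit of steady paths of index 0 contributes a class.\<close>

lemma HH_0_basis:
  "freely_spanned_by_classes Q R 0 (verts Q <+> {C. cocomplete_circuit Q R C} <+> zero_loops)
     (case_sum (\<lambda>e. pair (vpath e) (vpath e))
      (case_sum (\<lambda>C. pair (rep C) (vpath (src (rep C))))
                (\<lambda>a. pair (arrow Q a) (vpath (src (arrow Q a)))))
      :: _ \<Rightarrow> ('v, 'a, 'k::field) chain)"
proof (rule freely_spanned_by_classesI[where A = "{}" and
      w = "case_sum vpath (case_sum rep (arrow Q))"])
  let ?J = "verts Q <+> {C. cocomplete_circuit Q R C} <+> zero_loops"
    and ?w = "case_sum vpath (case_sum rep (arrow Q))"
  have lower_cycles: "?w j \<in> lower_cycles 0" if "j \<in> ?J" for j
    using that cocomplete_steady arrow_steady by (auto simp: lower_0_iff)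
  show "?w j \<in> lower_cycles 0" if "j \<in> ?J" for j
    using that by (rule lower_cycles)
  show "case_sum (\<lambda>e. pair (vpath e) (vpath e))
      (case_sum (\<lambda>C. pair (rep C) (vpath (src (rep C))))
                (\<lambda>a. pair (arrow Q a) (vpath (src (arrow Q a))))) j = (basis_chain 0 (?w j) :: ('v, 'a, 'k) chain)"
    if "j \<in> ?J" for j
    using that cocomplete_steady(2) arrow_steady
    by (auto simp: pair_vertex pair_vertex_right steady_admissible)
  show "\<exists>j\<in>?J. \<exists>i. ?w j = (rot_right Q ^^ i) c" if "c \<in> lower_cycles 0" for c
  proof -
    have "(\<exists>e\<in>verts Q. c = vpath e) \<or> (\<exists>a\<in>zero_loops. c = arrow Q a) \<or>
        (c \<in> qcycles Q \<and> successively (\<lambda>a b. \<not> rel a b) (snd c @ snd c))"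
      using that by (auto simp: lower_0_iff steady_0_iff)
    then show ?thesis
    proof (elim disjE bexE conjE)
      assume "c \<in> qcycles Q" "successively (\<lambda>a b. \<not> rel a b) (snd c @ snd c)"
      then show ?thesis
        using cocomplete_orbit[of c] by (intro bexI[of _ "Inr (Inl (orbit c))"]) auto
    next
      fix e assume "e \<in> verts Q" "c = vpath e"
      then show ?thesis
        by (intro bexI[of _ "Inl e"]) auto
    next
      fix a assume "a \<in> zero_loops" "c = arrow Q a"
      then show ?thesis
        by (intro bexI[of _ "Inr (Inr a)"]) auto
    qed
  qed
  show "j' = j" if "j \<in> ?J" "j' \<in> ?J" "?w j' = (rot_right Q ^^ i) (?w j)" for j j' i
    using that cocomplete_steady(1) rep_inj cocomplete_not_arrow cocomplete_not_arrow[where i = 0]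
      rep_neq_vpath rep_neq_vpath[where i = 0]
    by (elim PlusE; simp; metis)
qed (auto simp: upper_0)

text \<open>The upper cycles have index 0, being cocomplete cycles and loops with square in I, and
  their sign \<open>(-1)^(2*r)\<close> is always 1. The lower cycles have index 1 and so are
  complete of length 2, with sign \<open>(-1)^r\<close>.\<close>

lemma HH_1_basis:
  "freely_spanned_by_classes Q R 1
     ({C. cocomplete_circuit Q R C} <+> zero_loops
        <+> {C \<in> circuits_of_length Q 2. complete_circuit Q R C \<and> (-1) ^ period Q C = (1::'k)})
     (case_sum (\<lambda>C. \<Sum>i<period Q C. pair (but_first Q ((rot Q ^^ i) (rep C)))
                                             (first_arrow Q ((rot Q ^^ i) (rep C))))
      (case_sum (\<lambda>a. pair (vpath (src (arrow Q a))) (arrow Q a))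
                (\<lambda>C. pair (last_arrow Q (rep C)) (but_last (rep C))))
      :: _ \<Rightarrow> ('v, 'a, 'k::field) chain)"
  (is "freely_spanned_by_classes Q R 1 ({C. cocomplete_circuit Q R C} <+> zero_loops <+> ?CC) ?z")
proof (rule freely_spanned_by_classesI[where
      A = "Inl ` {C. cocomplete_circuit Q R C} \<union> (Inr \<circ> Inl) ` zero_loops" and
      B = "(Inr \<circ> Inr) ` ?CC" and w = "case_sum rep (case_sum (arrow Q) rep)"])
  let ?A = "Inl ` {C. cocomplete_circuit Q R C} \<union> (Inr \<circ> Inl) ` zero_loops"
    and ?B = "(Inr \<circ> Inr) ` ?CC" and ?w = "case_sum rep (case_sum (arrow Q) rep)"
  show "{C. cocomplete_circuit Q R C} <+> zero_loops <+> ?CC = ?A \<union> ?B"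
    by (auto simp: Plus_def image_Un image_comp)
  show "?w j \<in> upper_cycles 1" if "j \<in> ?A" for j
    using that cocomplete_steady(2) arrow_steady by (auto simp: upper_Suc)
  show "?z j = (\<Sum>i<rot_period (?w j). scale ((-1) ^ (Suc 1 * i)) (basis_chain 1 ((rot_right Q ^^ i) (?w j))))"
    if "j \<in> ?A" for j
  proof -
    have "(\<Sum>i<period Q C. pair (but_first Q ((rot Q ^^ i) (rep C))) (first_arrow Q ((rot Q ^^ i) (rep C)))) =
        (\<Sum>i<rot_period (rep C). basis_chain 1 ((rot_right Q ^^ i) (rep C)) :: ('v, 'a, 'k) chain)"
      if "cocomplete_circuit Q R C" for C
      using cocomplete_steady[OF that] rot_right_funpow_steady[of "rep C" 0]
      by (simp add: period_rep rep_qcycle rot_funpow_eq pair_first_arrow steady_admissible_Suc)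
    moreover have "pair (vpath (src (arrow Q a))) (arrow Q a) = (basis_chain 1 (arrow Q a) :: ('v, 'a, 'k) chain)"
      if "a \<in> zero_loops" for a
      using steady_admissible_Suc[OF arrow_steady[OF that]]
      by (intro pair_vertex_left) (simp_all add: arrow_def)
    ultimately show ?thesis
      \<comment> \<open>The exponents \<open>Suc 1 * i\<close> are even, so the signs of the general
        form disappear. A loop has period 1 and gives a sum with one term.\<close>
      using that by (auto simp: power_mult)
  qed
  show "\<exists>j\<in>?A. \<exists>i. ?w j = (rot_right Q ^^ i) c" if "c \<in> upper_cycles 1" for c
  proof -
    have "(\<exists>a\<in>zero_loops. c = arrow Q a) \<or>
        (c \<in> qcycles Q \<and> successively (\<lambda>a b. \<not> rel a b) (snd c @ snd c))"
      using that by (auto simp: upper_Suc steady_0_iff)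
    then show ?thesis
    proof (elim disjE bexE conjE)
      assume "c \<in> qcycles Q" "successively (\<lambda>a b. \<not> rel a b) (snd c @ snd c)"
      then show ?thesis
        using cocomplete_orbit[of c] by (intro bexI[of _ "Inl (orbit c)"]) auto
    next
      fix a assume "a \<in> zero_loops" "c = arrow Q a"
      then show ?thesis
        by (intro bexI[of _ "Inr (Inl a)"]) auto
    qed
  qed
  show "j' = j" if "j \<in> ?A" "j' \<in> ?A" "?w j' = (rot_right Q ^^ i) (?w j)" for j j' i
    using that cocomplete_steady(1) rep_inj cocomplete_not_arrow cocomplete_not_arrow[where i = 0]
    by (elim UnE imageE; simp; metis)
  have CC: "C \<in> circuits Q" "rep C \<in> steady (Suc 0)" "length (snd (rep C)) = Suc (Suc 0)"
    "(-1) ^ rot_period (rep C) = (1::'k)" if "C \<in> ?CC" for C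
    using that complete_steady[of C "Suc 0"] period_rep[of C] by (auto simp: numeral_2_eq_2)
  show "?w j \<in> lower_cycles 1" if "j \<in> ?B" for j
    using that CC(2) by (auto simp: lower_Suc)
  show "?z j = basis_chain 1 (?w j)" if "j \<in> ?B" for j
    using that CC(2,3) by (auto simp: pair_last_arrow steady_admissible)
  show "(-1) ^ (1 * rot_period (?w j)) = (1::'k)" if "j \<in> ?B" for j
    using that CC(4) by auto
  show "\<exists>j\<in>?B. \<exists>i. ?w j = (rot_right Q ^^ i) c"
    if "c \<in> lower_cycles 1" "(-1) ^ (1 * rot_period c) = (1::'k)" for c
    using that steady_Suc_orbit[of c 0]
    by (intro bexI[of _ "Inr (Inr (orbit c))"]) (auto simp: lower_Suc numeral_2_eq_2)
  show "j' = j" if "j \<in> ?B" "j' \<in> ?B" "?w j' = (rot_right Q ^^ i) (?w j)" for j j' i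
    using that by (elim imageE) (metis (no_types, lifting) CC(1) comp_apply rep_inj sum.case(2))
qed (simp_all add: power_mult)

text \<open>Both indices m - 1 and m are positive, which excludes cocomplete circuits and vertices:
  the upper cycles are complete of length m, the lower ones complete of length m + 1.\<close>

lemma HH_Suc_Suc_basis:
  assumes m: "m = Suc (Suc k)"
  shows "freely_spanned_by_classes Q R m
     ({C \<in> circuits_of_length Q m.
         complete_circuit Q R C \<and> (-1) ^ ((m + 1) * period Q C) = (1::'k)}
      <+> {C \<in> circuits_of_length Q (m + 1).
         complete_circuit Q R C \<and> (-1) ^ (m * period Q C) = (1::'k)})
     (case_sum (\<lambda>C. \<Sum>i<period Q C. scale ((-1) ^ ((m + 1) * i))
                        (pair (vpath (src ((rot Q ^^ i) (rep C)))) ((rot Q ^^ i) (rep C))))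
               (\<lambda>C. pair (last_arrow Q (rep C)) (but_last (rep C)))
      :: _ \<Rightarrow> ('v, 'a, 'k::field) chain)"
  (is "freely_spanned_by_classes Q R m (?CA <+> ?CB) ?z")
proof (rule freely_spanned_by_classesI[where A = "Inl ` ?CA" and B = "Inr ` ?CB" and w = "case_sum rep rep"])
  let ?w = "case_sum rep rep"
  show "?CA <+> ?CB = Inl ` ?CA \<union> Inr ` ?CB"
    by (simp add: Plus_def)
  have CA: "C \<in> circuits Q" "rep C \<in> steady (Suc k)" "length (snd (rep C)) = m"
    "(-1) ^ (Suc m * rot_period (rep C)) = (1::'k)" "period Q C = rot_period (rep C)" if "C \<in> ?CA" for C
    using that complete_steady[of C "Suc k"] period_rep[of C] by (auto simp: m)
  show "?w j \<in> upper_cycles m" if "j \<in> Inl ` ?CA" for j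
    using that CA(2) by (auto simp: upper_Suc m)
  show "(-1) ^ (Suc m * rot_period (?w j)) = (1::'k)" if "j \<in> Inl ` ?CA" for j
    using that CA(4) by auto
  show "?z j = (\<Sum>i<rot_period (?w j). scale ((-1) ^ (Suc m * i)) (basis_chain m ((rot_right Q ^^ i) (?w j))))"
    if j: "j \<in> Inl ` ?CA" for j
  proof -
    obtain C where C: "C \<in> ?CA" "j = Inl C"
      using j by blast
    have "pair (vpath (src ((rot Q ^^ i) (rep C)))) ((rot Q ^^ i) (rep C)) =
        (basis_chain m ((rot_right Q ^^ i) (rep C)) :: ('v, 'a, 'k) chain)" for i
      using CA[OF C(1)] steady_admissible_Suc[OF rot_right_funpow_steady[OF CA(2)[OF C(1)]], of i]
      by (simp add: rot_funpow_eq rep_qcycle pair_vertex_left m)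
    then show ?thesis
      using CA(5)[OF C(1)] by (simp add: C(2))
  qed
  show "\<exists>j\<in>Inl ` ?CA. \<exists>i. ?w j = (rot_right Q ^^ i) c"
    if "c \<in> upper_cycles m" "(-1) ^ (Suc m * rot_period c) = (1::'k)" for c
    using that steady_Suc_orbit[of c k]
    by (intro bexI[of _ "Inl (orbit c)"]) (auto simp: upper_Suc m)
  show "j' = j" if "j \<in> Inl ` ?CA" "j' \<in> Inl ` ?CA" "?w j' = (rot_right Q ^^ i) (?w j)" for j j' i
    using that by (elim imageE) (metis (no_types, lifting) CA(1) rep_inj sum.case(1))
  have CB: "C \<in> circuits Q" "rep C \<in> steady m" "length (snd (rep C)) = Suc m"
    "(-1) ^ (m * rot_period (rep C)) = (1::'k)" if "C \<in> ?CB" for C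
    using that complete_steady[of C m] period_rep[of C] by auto
  show "?w j \<in> lower_cycles m" if "j \<in> Inr ` ?CB" for j
    using that CB(2) by (auto simp: lower_cycles_def)
  show "?z j = basis_chain m (?w j)" if "j \<in> Inr ` ?CB" for j
    using that CB(2,3) by (auto simp: pair_last_arrow steady_admissible)
  show "(-1) ^ (m * rot_period (?w j)) = (1::'k)" if "j \<in> Inr ` ?CB" for j
    using that CB(4) by auto
  show "\<exists>j\<in>Inr ` ?CB. \<exists>i. ?w j = (rot_right Q ^^ i) c"
    if "c \<in> lower_cycles m" "(-1) ^ (m * rot_period c) = (1::'k)" for c
    using that steady_Suc_orbit[of c "Suc k"]
    by (intro bexI[of _ "Inr (orbit c)"]) (auto simp: lower_Suc m)
  show "j' = j" if "j \<in> Inr ` ?CB" "j' \<in> Inr ` ?CB" "?w j' = (rot_right Q ^^ i) (?w j)" for j j' i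
    using that by (elim imageE) (metis (no_types, lifting) CB(1) rep_inj sum.case(2))
qed

end

end

theorem theorem4p4:
  fixes Q :: "('v, 'a) pre_digraph" and R :: "('v, 'a) qpath set"
    and rep :: "('v, 'a) qpath set \<Rightarrow> ('v, 'a) qpath"
  assumes "quadratic_monomial_presentation Q R"
    and "\<forall>C\<in>circuits Q. rep C \<in> C"
  shows
    "(freely_spanned_by_classes Q R 0
       (verts Q
        <+> {C. cocomplete_circuit Q R C}
        <+> {a \<in> arcs Q. tail Q a = head Q a \<and>
               Poly_Mapping.single (arrow Q a \<cdot> arrow Q a) (1::'k::field) \<in> pres_ideal Q R})
       (case_sum (\<lambda>e. pair (vpath e) (vpath e))
        (case_sum (\<lambda>C. pair (rep C) (vpath (src (rep C))))
                  (\<lambda>a. pair (arrow Q a) (vpath (src (arrow Q a)))))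
        :: _ \<Rightarrow> ('v, 'a, 'k) chain)) \<and>
    (freely_spanned_by_classes Q R 1
       ({C. cocomplete_circuit Q R C}
        <+> {a \<in> arcs Q. tail Q a = head Q a \<and>
               Poly_Mapping.single (arrow Q a \<cdot> arrow Q a) (1::'k) \<in> pres_ideal Q R}
        <+> {C \<in> circuits_of_length Q 2. complete_circuit Q R C \<and> (-1) ^ period Q C = (1::'k)})
       (case_sum (\<lambda>C. \<Sum>i<period Q C. pair (but_first Q ((rot Q ^^ i) (rep C)))
                                               (first_arrow Q ((rot Q ^^ i) (rep C))))
        (case_sum (\<lambda>a. pair (vpath (src (arrow Q a))) (arrow Q a))
                  (\<lambda>C. pair (last_arrow Q (rep C)) (but_last (rep C))))
        :: _ \<Rightarrow> ('v, 'a, 'k) chain)) \<and>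
    (\<forall>m\<ge>2. freely_spanned_by_classes Q R m
       ({C \<in> circuits_of_length Q m.
           complete_circuit Q R C \<and> (-1) ^ ((m + 1) * period Q C) = (1::'k)}
        <+> {C \<in> circuits_of_length Q (m + 1).
           complete_circuit Q R C \<and> (-1) ^ (m * period Q C) = (1::'k)})
       (case_sum (\<lambda>C. \<Sum>i<period Q C. scale ((-1) ^ ((m + 1) * i))
                          (pair (vpath (src ((rot Q ^^ i) (rep C)))) ((rot Q ^^ i) (rep C))))
                 (\<lambda>C. pair (last_arrow Q (rep C)) (but_last (rep C)))
        :: _ \<Rightarrow> ('v, 'a, 'k) chain))"
proof -
  interpret quadratic_monomial_presentation Q R
    by fact
  show ?thesis
    unfolding loops_in_ideal_eq
  proof (intro conjI allI impI)
    fix m :: nat assume "m \<ge> 2"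
    then obtain k where "m = Suc (Suc k)"
      by (metis add_2_eq_Suc le_Suc_ex)
    then show "freely_spanned_by_classes Q R m
       ({C \<in> circuits_of_length Q m.
           complete_circuit Q R C \<and> (-1) ^ ((m + 1) * period Q C) = (1::'k)}
        <+> {C \<in> circuits_of_length Q (m + 1).
           complete_circuit Q R C \<and> (-1) ^ (m * period Q C) = (1::'k)})
       (case_sum (\<lambda>C. \<Sum>i<period Q C. scale ((-1) ^ ((m + 1) * i))
                          (pair (vpath (src ((rot Q ^^ i) (rep C)))) ((rot Q ^^ i) (rep C))))
                 (\<lambda>C. pair (last_arrow Q (rep C)) (but_last (rep C)))
        :: _ \<Rightarrow> ('v, 'a, 'k) chain)"
      by (rule HH_Suc_Suc_basis[OF assms(2)])
  qed (rule HH_0_basis[OF assms(2)] HH_1_basis[OF assms(2)])+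
qed

end
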